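(* Consider a calculus category whose coalgebra modality is monoidal, with deriving transformation $\mathsf{d}$ and integral transformation $\mathsf{s}$. If $\mathsf{s}$ is monoidal, then $\mathsf{s}$ is the antiderivative integral transformation; that is, $\mathsf{K}=\mathsf{d}^\circ\mathsf{d}+{!}(0)$ is a natural isomorphism and $\mathsf{s}=\mathsf{K}^{-1}\mathsf{d}^\circ$.
   Context: Conventions. Composition is in diagrammatic order: $fg$ means first $f$, then $g$. Symmetric monoidal categories are treated as strict; $\otimes$ is the tensor, $I$ the unit, $\sigma$ the symmetry, $1$ an identity map. An additive category is a category enriched in commutative monoids (no negatives or biproducts assumed): hom-sets have $+$ and $0$ with $k(f+g)h=kfh+kgh$, $0f=0$, $f0=0$. An additive symmetric monoidal category is a symmetric monoidal category that is additive with $k\otimes(f+g)\otimes h=k\otimes f\otimes h+k\otimes g\otimes h$, $0\otimes h=0$, $h\otimes 0=0$. A coalgebra modality $(!,\delta,\varepsilon,\Delta,e)$ is a comonad $(!,\delta,\varepsilon)$ with natural transformations $\Delta_A:{!}A\to{!}A\otimes{!}A$ and $e_A:{!}A\to I$ such that each $({!}A,\Delta_A,e_A)$ is a cocommutative comonoid and $\delta\Delta=\Delta(\delta\otimes\delta)$. The coderiving transformation is $\mathsf{d}^\circ_A=\Delta_A(1_{!A}\otimes\varepsilon_A):{!}A\to{!}A\otimes A$. The coalgebra modality is monoidal if it comes with $m_\otimes:{!}A\otimes{!}B\to{!}(A\otimes B)$ (natural) and $m_I:I\to{!}I$ making $(!,\delta,\varepsilon,m_\otimes,m_I)$ a (lax)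 symmetric monoidal comonad ($!$ a symmetric monoidal functor, $\delta,\varepsilon$ monoidal transformations) such that $\Delta$ and $e$ are monoidal transformations: $m_\otimes\Delta=(\Delta\otimes\Delta)(1\otimes\sigma\otimes1)(m_\otimes\otimes m_\otimes)$, $m_\otimes e=e\otimes e$, $m_I\Delta=m_I\otimes m_I$, $m_Ie=1$; and $\Delta,e$ are $!$-coalgebra morphisms: $\delta\,{!}(\Delta)=\Delta(\delta\otimes\delta)m_\otimes$, $\delta\,{!}(e)=e\,m_I$. A deriving transformation is a natural transformation $\mathsf{d}_A:{!}A\otimes A\to{!}A$ such that [d.1] $\mathsf{d}e=0$; [d.2] $\mathsf{d}\Delta=(\Delta\otimes1)(1\otimes\sigma)(\mathsf{d}\otimes1)+(\Delta\otimes1)(1\otimes\mathsf{d})$; [d.3] $\mathsf{d}\varepsilon=e\otimes1$; [d.4] $\mathsf{d}\delta=(\Delta\otimes1)(\delta\otimes1\otimes1)(1\otimes\mathsf{d})\mathsf{d}$; [d.5] $(\mathsf{d}\otimes1)\mathsf{d}=(1\otimes\sigma)(\mathsf{d}\otimes1)\mathsf{d}$. An integral transformation is a natural transformation $\mathsf{s}_A:{!}A\to{!}A\otimes A$ such that [s.1] $\mathsf{s}(e\otimes1)=\varepsilon$; [s.2] $\Delta(\mathsf{s}\otimes\mathsf{s})=\mathsf{s}(\Delta\otimes1)(\mathsf{s}\otimes1\otimes1)+\mathsf{s}(\Delta\otimes1)(1\otimes\sigma)(1\otimes1\otimes\mathsf{s})$; [s.3] $\mathsf{s}(\mathsf{s}\otimes1)=\mathsf{s}(\mathsf{s}\otimes1)(1\otimes\sigma)$.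 For a monoidal coalgebra modality, $\mathsf{s}$ is monoidal if $m_\otimes\mathsf{s}=(\mathsf{s}\otimes\mathsf{d}^\circ)(1\otimes\sigma\otimes1)(m_\otimes\otimes1\otimes1)=(\mathsf{d}^\circ\otimes\mathsf{s})(1\otimes\sigma\otimes1)(m_\otimes\otimes1\otimes1)$ as maps ${!}A\otimes{!}B\to{!}(A\otimes B)\otimes A\otimes B$. Write $!(0):{!}A\to{!}A$ for $!$ applied to the zero map. A calculus category is an additive symmetric monoidal category with a coalgebra modality, a deriving transformation $\mathsf{d}$ and an integral transformation $\mathsf{s}$ on the same coalgebra modality such that: (Second Fundamental Theorem of Calculus) $\mathsf{s}\mathsf{d}+{!}(0)=1$; and (Poincaré condition) for all objects $A,B,C$, every $f:C\otimes{!}A\otimes A\to B$ with $(1\otimes1\otimes\sigma)(1\otimes\mathsf{d}\otimes1)f=(1\otimes\mathsf{d}\otimes1)f$ satisfies $(1\otimes\mathsf{d}\mathsf{s})f=f$. *)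

theory Defs
  imports Main
begin

text \<open>
  Objects and maps are given by carrier sets inside arbitrary types, and all axioms are
  relativised to these carriers; operations are unconstrained on arguments outside their
  intended domain. Composition is written in diagrammatic order, so \<open>f \<cdot> g\<close> means
  ``first \<open>f\<close>, then \<open>g\<close>''. In terms, \<open>\<otimes>\<close> binds tighter than \<open>\<cdot>\<close>, which binds tighter
  than \<open>\<oplus>\<close>.
\<close>

section \<open>Categories, functors and natural transformations\<close>

record ('o, 'm) cat =
  Obj :: "'o set"
  Arr :: "'m set"
  Dom :: "'m \<Rightarrow> 'o"
  Cod :: "'m \<Rightarrow> 'o"
  Id :: "'o \<Rightarrow> 'm"  ("\<one>\<index>")
  Comp :: "'m \<Rightarrow> 'm \<Rightarrow> 'm"  (infixl "\<cdot>\<index>" 60)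

definition hom :: "('o, 'm, 'x) cat_scheme \<Rightarrow> 'o \<Rightarrow> 'o \<Rightarrow> 'm set"  ("Hom\<index>")
  where "Hom\<^bsub>C\<^esub> A B = {f \<in> Arr C. Dom C f = A \<and> Cod C f = B}"

locale category =
  fixes C :: "('o, 'm, 'x) cat_scheme" (structure)
  assumes Dom_Obj: "f \<in> Arr C \<Longrightarrow> Dom C f \<in> Obj C"
    and Cod_Obj: "f \<in> Arr C \<Longrightarrow> Cod C f \<in> Obj C"
    and Id_hom: "A \<in> Obj C \<Longrightarrow> \<one> A \<in> Hom A A"
    and Comp_hom: "f \<in> Hom X Y \<Longrightarrow> g \<in> Hom Y Z \<Longrightarrow> f \<cdot> g \<in> Hom X Z"
    and Id_left: "f \<in> Hom X Y \<Longrightarrow> \<one> X \<cdot> f = f"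
    and Id_right: "f \<in> Hom X Y \<Longrightarrow> f \<cdot> \<one> Y = f"
    and Comp_assoc: "f \<in> Hom W X \<Longrightarrow> g \<in> Hom X Y \<Longrightarrow> h \<in> Hom Y Z
      \<Longrightarrow> (f \<cdot> g) \<cdot> h = f \<cdot> (g \<cdot> h)"

definition inverse_maps :: "('o, 'm, 'x) cat_scheme \<Rightarrow> 'm \<Rightarrow> 'm \<Rightarrow> bool"
  where "inverse_maps C f g \<longleftrightarrow>
    f \<in> Arr C \<and> g \<in> Hom\<^bsub>C\<^esub> (Cod C f) (Dom C f)
    \<and> f \<cdot>\<^bsub>C\<^esub> g = \<one>\<^bsub>C\<^esub> (Dom C f) \<and> g \<cdot>\<^bsub>C\<^esub> f = \<one>\<^bsub>C\<^esub> (Cod C f)"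

definition isomorphism :: "('o, 'm, 'x) cat_scheme \<Rightarrow> 'm \<Rightarrow> bool"
  where "isomorphism C f \<longleftrightarrow> (\<exists>g. inverse_maps C f g)"

definition inverse_map :: "('o, 'm, 'x) cat_scheme \<Rightarrow> 'm \<Rightarrow> 'm"
  where "inverse_map C f = (THE g. inverse_maps C f g)"

text \<open>A functor is given by its action on objects together with its action on maps.\<close>

definition endofunctor ::
  "('o, 'm, 'x) cat_scheme \<Rightarrow> ('o \<Rightarrow> 'o) \<Rightarrow> ('m \<Rightarrow> 'm) \<Rightarrow> bool"
  where "endofunctor C F Fm \<longleftrightarrow>
    (\<forall>A \<in> Obj C. F A \<in> Obj C)
    \<and> (\<forall>X Y. \<forall>f \<in> Hom\<^bsub>C\<^esub> X Y. Fm f \<in> Hom\<^bsub>C\<^esub> (F X) (F Y))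
    \<and> (\<forall>A \<in> Obj C. Fm (\<one>\<^bsub>C\<^esub> A) = \<one>\<^bsub>C\<^esub> (F A))
    \<and> (\<forall>X Y Z. \<forall>f \<in> Hom\<^bsub>C\<^esub> X Y. \<forall>g \<in> Hom\<^bsub>C\<^esub> Y Z.
        Fm (f \<cdot>\<^bsub>C\<^esub> g) = Fm f \<cdot>\<^bsub>C\<^esub> Fm g)"

definition natural_transformation ::
  "('o, 'm, 'x) cat_scheme \<Rightarrow> ('o \<Rightarrow> 'o) \<Rightarrow> ('m \<Rightarrow> 'm) \<Rightarrow> ('o \<Rightarrow> 'o) \<Rightarrow> ('m \<Rightarrow> 'm)
    \<Rightarrow> ('o \<Rightarrow> 'm) \<Rightarrow> bool"
  where "natural_transformation C F Fm G Gm t \<longleftrightarrow>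
    (\<forall>A \<in> Obj C. t A \<in> Hom\<^bsub>C\<^esub> (F A) (G A))
    \<and> (\<forall>X Y. \<forall>f \<in> Hom\<^bsub>C\<^esub> X Y. Fm f \<cdot>\<^bsub>C\<^esub> t Y = t X \<cdot>\<^bsub>C\<^esub> Gm f)"

definition natural_isomorphism ::
  "('o, 'm, 'x) cat_scheme \<Rightarrow> ('o \<Rightarrow> 'o) \<Rightarrow> ('m \<Rightarrow> 'm) \<Rightarrow> ('o \<Rightarrow> 'o) \<Rightarrow> ('m \<Rightarrow> 'm)
    \<Rightarrow> ('o \<Rightarrow> 'm) \<Rightarrow> bool"
  where "natural_isomorphism C F Fm G Gm t \<longleftrightarrow>
    natural_transformation C F Fm G Gm t \<and> (\<forall>A \<in> Obj C. isomorphism C (t A))"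


section \<open>Additive symmetric monoidal categories\<close>

text \<open>
  The monoidal structure is strict: associativity and unit laws are equalities of objects
  and of maps. \<open>\<odot>\<close> is the tensor of objects and \<open>\<otimes>\<close> the tensor of maps.
\<close>

record ('o, 'm) smc = "('o, 'm) cat" +
  TensorO :: "'o \<Rightarrow> 'o \<Rightarrow> 'o"  (infixl "\<odot>\<index>" 70)
  TensorM :: "'m \<Rightarrow> 'm \<Rightarrow> 'm"  (infixl "\<otimes>\<index>" 70)
  UnitO :: "'o"  ("\<I>\<index>")
  Sym :: "'o \<Rightarrow> 'o \<Rightarrow> 'm"  ("\<sigma>\<index>")

locale symmetric_monoidal_category = category C
  for C :: "('o, 'm, 'x) smc_scheme" (structure) +
  assumes TensorO_Obj: "A \<in> Obj C \<Longrightarrow> B \<in> Obj C \<Longrightarrow> A \<odot> B \<in> Obj C"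
    and UnitO_Obj: "\<I> \<in> Obj C"
    and TensorM_hom: "f \<in> Hom X Y \<Longrightarrow> g \<in> Hom X' Y' \<Longrightarrow> f \<otimes> g \<in> Hom (X \<odot> X') (Y \<odot> Y')"
    and TensorM_Id: "A \<in> Obj C \<Longrightarrow> B \<in> Obj C \<Longrightarrow> \<one> A \<otimes> \<one> B = \<one> (A \<odot> B)"
    and TensorM_Comp: "f \<in> Hom X Y \<Longrightarrow> g \<in> Hom Y Z \<Longrightarrow> f' \<in> Hom X' Y' \<Longrightarrow> g' \<in> Hom Y' Z'
      \<Longrightarrow> (f \<cdot> g) \<otimes> (f' \<cdot> g') = (f \<otimes> f') \<cdot> (g \<otimes> g')"
    and TensorO_assoc: "A \<in> Obj C \<Longrightarrow> B \<in> Obj C \<Longrightarrow> D \<in> Obj C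
      \<Longrightarrow> (A \<odot> B) \<odot> D = A \<odot> (B \<odot> D)"
    and TensorM_assoc: "f \<in> Arr C \<Longrightarrow> g \<in> Arr C \<Longrightarrow> h \<in> Arr C
      \<Longrightarrow> (f \<otimes> g) \<otimes> h = f \<otimes> (g \<otimes> h)"
    and UnitO_left: "A \<in> Obj C \<Longrightarrow> \<I> \<odot> A = A"
    and UnitO_right: "A \<in> Obj C \<Longrightarrow> A \<odot> \<I> = A"
    and UnitM_left: "f \<in> Arr C \<Longrightarrow> \<one> \<I> \<otimes> f = f"
    and UnitM_right: "f \<in> Arr C \<Longrightarrow> f \<otimes> \<one> \<I> = f"
    and Sym_hom: "A \<in> Obj C \<Longrightarrow> B \<in> Obj C \<Longrightarrow> \<sigma> A B \<in> Hom (A \<odot> B) (B \<odot> A)"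
    and Sym_natural: "f \<in> Hom X Y \<Longrightarrow> g \<in> Hom X' Y'
      \<Longrightarrow> (f \<otimes> g) \<cdot> \<sigma> Y Y' = \<sigma> X X' \<cdot> (g \<otimes> f)"
    and Sym_Sym: "A \<in> Obj C \<Longrightarrow> B \<in> Obj C \<Longrightarrow> \<sigma> A B \<cdot> \<sigma> B A = \<one> (A \<odot> B)"
    and Sym_hexagon: "A \<in> Obj C \<Longrightarrow> B \<in> Obj C \<Longrightarrow> D \<in> Obj C
      \<Longrightarrow> \<sigma> A (B \<odot> D) = (\<sigma> A B \<otimes> \<one> D) \<cdot> (\<one> B \<otimes> \<sigma> A D)"
    and Sym_Unit: "A \<in> Obj C \<Longrightarrow> \<sigma> A \<I> = \<one> A"

record ('o, 'm) asmc = "('o, 'm) smc" +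
  Plus :: "'m \<Rightarrow> 'm \<Rightarrow> 'm"  (infixl "\<oplus>\<index>" 55)
  Zero :: "'o \<Rightarrow> 'o \<Rightarrow> 'm"  ("\<zero>\<index>")

locale additive_symmetric_monoidal_category = symmetric_monoidal_category C
  for C :: "('o, 'm, 'x) asmc_scheme" (structure) +
  assumes Plus_hom: "f \<in> Hom X Y \<Longrightarrow> g \<in> Hom X Y \<Longrightarrow> f \<oplus> g \<in> Hom X Y"
    and Zero_hom: "X \<in> Obj C \<Longrightarrow> Y \<in> Obj C \<Longrightarrow> \<zero> X Y \<in> Hom X Y"
    and Plus_assoc: "f \<in> Hom X Y \<Longrightarrow> g \<in> Hom X Y \<Longrightarrow> h \<in> Hom X Y
      \<Longrightarrow> (f \<oplus> g) \<oplus> h = f \<oplus> (g \<oplus> h)"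
    and Plus_comm: "f \<in> Hom X Y \<Longrightarrow> g \<in> Hom X Y \<Longrightarrow> f \<oplus> g = g \<oplus> f"
    and Plus_Zero: "f \<in> Hom X Y \<Longrightarrow> f \<oplus> \<zero> X Y = f"
    and Comp_Plus: "k \<in> Hom W X \<Longrightarrow> f \<in> Hom X Y \<Longrightarrow> g \<in> Hom X Y \<Longrightarrow> h \<in> Hom Y Z
      \<Longrightarrow> k \<cdot> (f \<oplus> g) \<cdot> h = k \<cdot> f \<cdot> h \<oplus> k \<cdot> g \<cdot> h"
    and Zero_Comp: "X \<in> Obj C \<Longrightarrow> f \<in> Hom Y Z \<Longrightarrow> \<zero> X Y \<cdot> f = \<zero> X Z"
    and Comp_Zero: "Z \<in> Obj C \<Longrightarrow> f \<in> Hom X Y \<Longrightarrow> f \<cdot> \<zero> Y Z = \<zero> X Z"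
    and Tensor_Plus: "k \<in> Hom W W' \<Longrightarrow> f \<in> Hom X Y \<Longrightarrow> g \<in> Hom X Y \<Longrightarrow> h \<in> Hom Z Z'
      \<Longrightarrow> k \<otimes> (f \<oplus> g) \<otimes> h = k \<otimes> f \<otimes> h \<oplus> k \<otimes> g \<otimes> h"
    and Zero_Tensor: "X \<in> Obj C \<Longrightarrow> Y \<in> Obj C \<Longrightarrow> h \<in> Hom Z Z'
      \<Longrightarrow> \<zero> X Y \<otimes> h = \<zero> (X \<odot> Z) (Y \<odot> Z')"
    and Tensor_Zero: "X \<in> Obj C \<Longrightarrow> Y \<in> Obj C \<Longrightarrow> h \<in> Hom Z Z'
      \<Longrightarrow> h \<otimes> \<zero> X Y = \<zero> (Z \<odot> X) (Z' \<odot> Y)"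


section \<open>Coalgebra modalities\<close>

text \<open>The endofunctor \<open>!\<close> is written \<open>\<B>\<close> on objects and \<open>\<M>\<close> on maps.\<close>

record ('o, 'm) coalg_cat = "('o, 'm) asmc" +
  BangO :: "'o \<Rightarrow> 'o"  ("\<B>\<index>")
  BangM :: "'m \<Rightarrow> 'm"  ("\<M>\<index>")
  Delta :: "'o \<Rightarrow> 'm"  ("\<delta>\<index>")
  Epsilon :: "'o \<Rightarrow> 'm"  ("\<epsilon>\<index>")
  Comult :: "'o \<Rightarrow> 'm"  ("\<Delta>\<index>")
  Counit :: "'o \<Rightarrow> 'm"  ("\<e>\<index>")

locale coalgebra_modality = additive_symmetric_monoidal_category C
  for C :: "('o, 'm, 'x) coalg_cat_scheme" (structure) +
  assumes Bang_functor: "endofunctor C \<B> \<M>"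
    and Delta_natural: "natural_transformation C \<B> \<M> (\<lambda>A. \<B> (\<B> A)) (\<lambda>f. \<M> (\<M> f)) \<delta>"
    and Epsilon_natural: "natural_transformation C \<B> \<M> (\<lambda>A. A) (\<lambda>f. f) \<epsilon>"
    and Delta_Delta: "A \<in> Obj C \<Longrightarrow> \<delta> A \<cdot> \<delta> (\<B> A) = \<delta> A \<cdot> \<M> (\<delta> A)"
    and Delta_Epsilon: "A \<in> Obj C \<Longrightarrow> \<delta> A \<cdot> \<epsilon> (\<B> A) = \<one> (\<B> A)"
    and Delta_Bang_Epsilon: "A \<in> Obj C \<Longrightarrow> \<delta> A \<cdot> \<M> (\<epsilon> A) = \<one> (\<B> A)"
    and Comult_natural:
      "natural_transformation C \<B> \<M> (\<lambda>A. \<B> A \<odot> \<B> A) (\<lambda>f. \<M> f \<otimes> \<M> f) \<Delta>"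
    and Counit_natural: "natural_transformation C \<B> \<M> (\<lambda>A. \<I>) (\<lambda>f. \<one> \<I>) \<e>"
    and Comult_assoc: "A \<in> Obj C
      \<Longrightarrow> \<Delta> A \<cdot> (\<Delta> A \<otimes> \<one> (\<B> A)) = \<Delta> A \<cdot> (\<one> (\<B> A) \<otimes> \<Delta> A)"
    and Counit_left: "A \<in> Obj C \<Longrightarrow> \<Delta> A \<cdot> (\<e> A \<otimes> \<one> (\<B> A)) = \<one> (\<B> A)"
    and Counit_right: "A \<in> Obj C \<Longrightarrow> \<Delta> A \<cdot> (\<one> (\<B> A) \<otimes> \<e> A) = \<one> (\<B> A)"
    and Comult_comm: "A \<in> Obj C \<Longrightarrow> \<Delta> A \<cdot> \<sigma> (\<B> A) (\<B> A) = \<Delta> A"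
    and Delta_Comult: "A \<in> Obj C \<Longrightarrow> \<delta> A \<cdot> \<Delta> (\<B> A) = \<Delta> A \<cdot> (\<delta> A \<otimes> \<delta> A)"

definition coderiving :: "('o, 'm, 'x) coalg_cat_scheme \<Rightarrow> 'o \<Rightarrow> 'm"  ("\<d>\<index>")
  where "\<d>\<^bsub>C\<^esub> A = \<Delta>\<^bsub>C\<^esub> A \<cdot>\<^bsub>C\<^esub> (\<one>\<^bsub>C\<^esub> (\<B>\<^bsub>C\<^esub> A) \<otimes>\<^bsub>C\<^esub> \<epsilon>\<^bsub>C\<^esub> A)"

locale monoidal_coalgebra_modality = coalgebra_modality C
  for C :: "('o, 'm, 'x) coalg_cat_scheme" (structure) +
  fixes m :: "'o \<Rightarrow> 'o \<Rightarrow> 'm" and m\<^sub>I :: "'m"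
  assumes m_hom: "A \<in> Obj C \<Longrightarrow> B \<in> Obj C \<Longrightarrow> m A B \<in> Hom (\<B> A \<odot> \<B> B) (\<B> (A \<odot> B))"
    and m_natural: "f \<in> Hom X Y \<Longrightarrow> g \<in> Hom X' Y'
      \<Longrightarrow> (\<M> f \<otimes> \<M> g) \<cdot> m Y Y' = m X X' \<cdot> \<M> (f \<otimes> g)"
    and mI_hom: "m\<^sub>I \<in> Hom \<I> (\<B> \<I>)"
    \<comment> \<open>\<open>!\<close> is a lax symmetric monoidal functor\<close>
    and m_assoc: "A \<in> Obj C \<Longrightarrow> B \<in> Obj C \<Longrightarrow> D \<in> Obj C
      \<Longrightarrow> (m A B \<otimes> \<one> (\<B> D)) \<cdot> m (A \<odot> B) D = (\<one> (\<B> A) \<otimes> m B D) \<cdot> m A (B \<odot> D)"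
    and m_unit_left: "A \<in> Obj C \<Longrightarrow> (m\<^sub>I \<otimes> \<one> (\<B> A)) \<cdot> m \<I> A = \<one> (\<B> A)"
    and m_unit_right: "A \<in> Obj C \<Longrightarrow> (\<one> (\<B> A) \<otimes> m\<^sub>I) \<cdot> m A \<I> = \<one> (\<B> A)"
    and m_Sym: "A \<in> Obj C \<Longrightarrow> B \<in> Obj C \<Longrightarrow> m A B \<cdot> \<M> (\<sigma> A B) = \<sigma> (\<B> A) (\<B> B) \<cdot> m B A"
    \<comment> \<open>\<open>\<delta>\<close> and \<open>\<epsilon>\<close> are monoidal transformations\<close>
    and m_Delta: "A \<in> Obj C \<Longrightarrow> B \<in> Obj C
      \<Longrightarrow> m A B \<cdot> \<delta> (A \<odot> B) = (\<delta> A \<otimes> \<delta> B) \<cdot> m (\<B> A) (\<B> B) \<cdot> \<M> (m A B)"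
    and mI_Delta: "m\<^sub>I \<cdot> \<delta> \<I> = m\<^sub>I \<cdot> \<M> m\<^sub>I"
    and m_Epsilon: "A \<in> Obj C \<Longrightarrow> B \<in> Obj C \<Longrightarrow> m A B \<cdot> \<epsilon> (A \<odot> B) = \<epsilon> A \<otimes> \<epsilon> B"
    and mI_Epsilon: "m\<^sub>I \<cdot> \<epsilon> \<I> = \<one> \<I>"
    \<comment> \<open>\<open>\<Delta>\<close> and \<open>\<e>\<close> are monoidal transformations\<close>
    and m_Comult: "A \<in> Obj C \<Longrightarrow> B \<in> Obj C
      \<Longrightarrow> m A B \<cdot> \<Delta> (A \<odot> B) =
        (\<Delta> A \<otimes> \<Delta> B) \<cdot> (\<one> (\<B> A) \<otimes> \<sigma> (\<B> A) (\<B> B) \<otimes> \<one> (\<B> B)) \<cdot> (m A B \<otimes> m A B)"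
    and m_Counit: "A \<in> Obj C \<Longrightarrow> B \<in> Obj C \<Longrightarrow> m A B \<cdot> \<e> (A \<odot> B) = \<e> A \<otimes> \<e> B"
    and mI_Comult: "m\<^sub>I \<cdot> \<Delta> \<I> = m\<^sub>I \<otimes> m\<^sub>I"
    and mI_Counit: "m\<^sub>I \<cdot> \<e> \<I> = \<one> \<I>"
    \<comment> \<open>\<open>\<Delta>\<close> and \<open>\<e>\<close> are morphisms of \<open>!\<close>-coalgebras\<close>
    and Delta_Bang_Comult: "A \<in> Obj C
      \<Longrightarrow> \<delta> A \<cdot> \<M> (\<Delta> A) = \<Delta> A \<cdot> (\<delta> A \<otimes> \<delta> A) \<cdot> m (\<B> A) (\<B> A)"
    and Delta_Bang_Counit: "A \<in> Obj C \<Longrightarrow> \<delta> A \<cdot> \<M> (\<e> A) = \<e> A \<cdot> m\<^sub>I"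


section \<open>Deriving and integral transformations\<close>

locale deriving_transformation = coalgebra_modality C
  for C :: "('o, 'm, 'x) coalg_cat_scheme" (structure) +
  fixes d :: "'o \<Rightarrow> 'm"
  assumes d_natural:
      "natural_transformation C (\<lambda>A. \<B> A \<odot> A) (\<lambda>f. \<M> f \<otimes> f) \<B> \<M> d"
    and d_constant: "A \<in> Obj C \<Longrightarrow> d A \<cdot> \<e> A = \<zero> (\<B> A \<odot> A) \<I>"
    and d_product: "A \<in> Obj C \<Longrightarrow> d A \<cdot> \<Delta> A =
        (\<Delta> A \<otimes> \<one> A) \<cdot> (\<one> (\<B> A) \<otimes> \<sigma> (\<B> A) A) \<cdot> (d A \<otimes> \<one> (\<B> A))
        \<oplus> (\<Delta> A \<otimes> \<one> A) \<cdot> (\<one> (\<B> A) \<otimes> d A)"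
    and d_linear: "A \<in> Obj C \<Longrightarrow> d A \<cdot> \<epsilon> A = \<e> A \<otimes> \<one> A"
    and d_chain: "A \<in> Obj C \<Longrightarrow> d A \<cdot> \<delta> A =
        (\<Delta> A \<otimes> \<one> A) \<cdot> (\<delta> A \<otimes> \<one> (\<B> A) \<otimes> \<one> A) \<cdot> (\<one> (\<B> (\<B> A)) \<otimes> d A) \<cdot> d (\<B> A)"
    and d_interchange: "A \<in> Obj C \<Longrightarrow>
        (d A \<otimes> \<one> A) \<cdot> d A = (\<one> (\<B> A) \<otimes> \<sigma> A A) \<cdot> (d A \<otimes> \<one> A) \<cdot> d A"

locale integral_transformation = coalgebra_modality C
  for C :: "('o, 'm, 'x) coalg_cat_scheme" (structure) +
  fixes s :: "'o \<Rightarrow> 'm"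
  assumes s_natural:
      "natural_transformation C \<B> \<M> (\<lambda>A. \<B> A \<odot> A) (\<lambda>f. \<M> f \<otimes> f) s"
    and s_constant: "A \<in> Obj C \<Longrightarrow> s A \<cdot> (\<e> A \<otimes> \<one> A) = \<epsilon> A"
    and s_Rota_Baxter: "A \<in> Obj C \<Longrightarrow> \<Delta> A \<cdot> (s A \<otimes> s A) =
        s A \<cdot> (\<Delta> A \<otimes> \<one> A) \<cdot> (s A \<otimes> \<one> (\<B> A) \<otimes> \<one> A)
        \<oplus> s A \<cdot> (\<Delta> A \<otimes> \<one> A) \<cdot> (\<one> (\<B> A) \<otimes> \<sigma> (\<B> A) A) \<cdot> (\<one> (\<B> A) \<otimes> \<one> A \<otimes> s A)"
    and s_interchange: "A \<in> Obj C \<Longrightarrow>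
        s A \<cdot> (s A \<otimes> \<one> A) = s A \<cdot> (s A \<otimes> \<one> A) \<cdot> (\<one> (\<B> A) \<otimes> \<sigma> A A)"

locale monoidal_integral_transformation =
  monoidal_coalgebra_modality C m m\<^sub>I + integral_transformation C s
  for C :: "('o, 'm, 'x) coalg_cat_scheme" (structure)
    and m :: "'o \<Rightarrow> 'o \<Rightarrow> 'm" and m\<^sub>I :: "'m" and s :: "'o \<Rightarrow> 'm" +
  assumes s_monoidal_left: "A \<in> Obj C \<Longrightarrow> B \<in> Obj C \<Longrightarrow> m A B \<cdot> s (A \<odot> B) =
        (s A \<otimes> \<d> B) \<cdot> (\<one> (\<B> A) \<otimes> \<sigma> A (\<B> B) \<otimes> \<one> B) \<cdot> (m A B \<otimes> \<one> A \<otimes> \<one> B)"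
    and s_monoidal_right: "A \<in> Obj C \<Longrightarrow> B \<in> Obj C \<Longrightarrow> m A B \<cdot> s (A \<odot> B) =
        (\<d> A \<otimes> s B) \<cdot> (\<one> (\<B> A) \<otimes> \<sigma> A (\<B> B) \<otimes> \<one> B) \<cdot> (m A B \<otimes> \<one> A \<otimes> \<one> B)"


section \<open>Calculus categories\<close>

locale calculus_category =
  deriving_transformation C d + integral_transformation C s
  for C :: "('o, 'm, 'x) coalg_cat_scheme" (structure)
    and d :: "'o \<Rightarrow> 'm" and s :: "'o \<Rightarrow> 'm" +
  assumes second_fundamental_theorem:
      "A \<in> Obj C \<Longrightarrow> s A \<cdot> d A \<oplus> \<M> (\<zero> A A) = \<one> (\<B> A)"
    and Poincare: "X \<in> Obj C \<Longrightarrow> A \<in> Obj C \<Longrightarrow> B \<in> Obj C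
      \<Longrightarrow> f \<in> Hom (X \<odot> \<B> A \<odot> A) B
      \<Longrightarrow> (\<one> X \<otimes> \<one> (\<B> A) \<otimes> \<sigma> A A) \<cdot> (\<one> X \<otimes> d A \<otimes> \<one> A) \<cdot> f
          = (\<one> X \<otimes> d A \<otimes> \<one> A) \<cdot> f
      \<Longrightarrow> (\<one> X \<otimes> (d A \<cdot> s A)) \<cdot> f = f"

definition antiderivative_K :: "('o, 'm, 'x) coalg_cat_scheme \<Rightarrow> ('o \<Rightarrow> 'm) \<Rightarrow> 'o \<Rightarrow> 'm"
  where "antiderivative_K C d A = \<d>\<^bsub>C\<^esub> A \<cdot>\<^bsub>C\<^esub> d A \<oplus>\<^bsub>C\<^esub> \<M>\<^bsub>C\<^esub> (\<zero>\<^bsub>C\<^esub> A A)"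

end

theory Submission
  imports Defs
begin

text \<open>
  Think of a map \<open>f\<close> out of \<open>!A\<close> as a smooth function on \<open>A\<close>. Evaluating
  \<open>m\<^sub>I \<cdot> s \<I>\<close> on a function of one scalar variable integrates it over the unit interval, so
  \<open>average A = (m\<^sub>I \<cdot> s \<I> \<otimes> 1) \<cdot> m\<close> turns \<open>f\<close> into \<open>x \<mapsto> \<integral> f (t x) dt\<close>,
  and monoidality of \<open>s\<close> says exactly \<open>s = \<d> \<cdot> (average \<otimes> 1)\<close>. With
  \<open>J = \<d> \<cdot> d \<oplus> 1\<close> one has \<open>K \<cdot> \<d> = \<d> \<cdot> (J \<otimes> 1)\<close> and \<open>d \<cdot> K = (J \<otimes> 1) \<cdot> d\<close>.
  The coderiving transformation is monoidal, which makes \<open>s \<cdot> (\<d> \<otimes> 1)\<close> symmetric; with the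
  Second Fundamental Theorem this gives \<open>s \<cdot> (J \<otimes> 1) = \<d>\<close>. If moreover \<open>J\<close> and \<open>average\<close>
  commute, then \<open>K \<cdot> s = \<d>\<close> and \<open>s \<cdot> (average \<otimes> 1) \<cdot> d \<oplus> !0\<close> is a two-sided inverse of \<open>K\<close>.

  The commutation is the rule for differentiating \<open>m\<close> in one variable, which holds for every
  deriving transformation on a monoidal coalgebra modality: on the \<open>!\<close>-coalgebra
  \<open>P = !B \<otimes> !A\<close> the chain rule along the vector field \<open>1 \<otimes> d\<close> follows from the chain rule
  on \<open>!A\<close>, because \<open>\<Delta>\<close> is a morphism of \<open>!\<close>-coalgebras and so maps into \<open>!P\<close> are
  determined by their two components.
\<close>

section \<open>Typing and interchange in strict monoidal categories\<close>

context category
begin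

declare hom_def [simp] Dom_Obj [simp] Cod_Obj [simp]

lemma Id_typing [simp]:
  assumes "A \<in> Obj C"
  shows "\<one> A \<in> Arr C" "Dom C (\<one> A) = A" "Cod C (\<one> A) = A"
  using Id_hom[OF assms] by simp_all

lemma Comp_typing [simp]:
  assumes "f \<in> Arr C" "g \<in> Arr C" "Cod C f = Dom C g"
  shows "f \<cdot> g \<in> Arr C" "Dom C (f \<cdot> g) = Dom C f" "Cod C (f \<cdot> g) = Cod C g"
  using Comp_hom[of f "Dom C f" "Dom C g" g "Cod C g"] assms by simp_all

lemma Id_left' [simp]: "f \<in> Arr C \<Longrightarrow> Dom C f = X \<Longrightarrow> \<one> X \<cdot> f = f"
  using Id_left[of f X "Cod C f"] by simp

lemma Id_right' [simp]: "f \<in> Arr C \<Longrightarrow> Cod C f = Y \<Longrightarrow> f \<cdot> \<one> Y = f"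
  using Id_right[of f "Dom C f" Y] by simp

lemma Comp_assoc' [simp]:
  assumes "f \<in> Arr C" "g \<in> Arr C" "h \<in> Arr C" "Cod C f = Dom C g" "Cod C g = Dom C h"
  shows "(f \<cdot> g) \<cdot> h = f \<cdot> (g \<cdot> h)"
  using Comp_assoc[of f "Dom C f" "Dom C g" g "Dom C h" h "Cod C h"] assms by simp

text \<open>Simplification nests composites to the right, so an equation for
  \<open>f \<cdot> g\<close> stops matching once a further map follows. Attached with
  \<open>THEN\<close>, this rule gives the version with a tail \<open>r\<close>.\<close>

lemma comp_then:
  assumes "f \<cdot> g = h" "f \<in> Arr C" "g \<in> Arr C" "Cod C f = Dom C g" "r \<in> Arr C" "Cod C g = Dom C r"
  shows "f \<cdot> (g \<cdot> r) = h \<cdot> r"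
  using assms by (simp flip: Comp_assoc')

end

context symmetric_monoidal_category
begin

declare TensorO_Obj [simp] UnitO_Obj [simp] TensorO_assoc [simp] UnitO_left [simp]
  UnitO_right [simp] UnitM_left [simp] UnitM_right [simp] TensorM_assoc [simp] Sym_Unit [simp]

lemma TensorM_typing [simp]:
  assumes "f \<in> Arr C" "g \<in> Arr C"
  shows "f \<otimes> g \<in> Arr C" "Dom C (f \<otimes> g) = Dom C f \<odot> Dom C g" "Cod C (f \<otimes> g) = Cod C f \<odot> Cod C g"
  using TensorM_hom[of f "Dom C f" "Cod C f" g "Dom C g" "Cod C g"] assms by simp_all

lemma Sym_typing [simp]:
  assumes "A \<in> Obj C" "B \<in> Obj C"
  shows "\<sigma> A B \<in> Arr C" "Dom C (\<sigma> A B) = A \<odot> B" "Cod C (\<sigma> A B) = B \<odot> A"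
  using Sym_hom[OF assms] by simp_all

lemma Id_tensor [simp]: "A \<in> Obj C \<Longrightarrow> B \<in> Obj C \<Longrightarrow> \<one> (A \<odot> B) = \<one> A \<otimes> \<one> B"
  by (simp add: TensorM_Id)

text \<open>\<open>Id_tensor\<close> splits identities on tensor products, so
  \<open>Id_left'\<close> and \<open>Id_right'\<close> no longer match them; these are the unit laws
  in split form for two and three factors.\<close>

lemma Id_tensor_Comp [simp]:
  assumes "X \<in> Obj C" "Y \<in> Obj C" "f \<in> Arr C"
  shows "Cod C f = X \<odot> Y \<Longrightarrow> f \<cdot> (\<one> X \<otimes> \<one> Y) = f"
    and "Dom C f = X \<odot> Y \<Longrightarrow> (\<one> X \<otimes> \<one> Y) \<cdot> f = f"
    and "Z \<in> Obj C \<Longrightarrow> Cod C f = X \<odot> (Y \<odot> Z) \<Longrightarrow> f \<cdot> (\<one> X \<otimes> (\<one> Y \<otimes> \<one> Z)) = f"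
    and "Z \<in> Obj C \<Longrightarrow> Dom C f = X \<odot> (Y \<odot> Z) \<Longrightarrow> (\<one> X \<otimes> (\<one> Y \<otimes> \<one> Z)) \<cdot> f = f"
  using assms Id_left'[of f "X \<odot> Y"] Id_right'[of f "X \<odot> Y"]
    Id_left'[of f "X \<odot> (Y \<odot> Z)"] Id_right'[of f "X \<odot> (Y \<odot> Z)"] by simp_all

lemma Sym_Unit_left [simp]: "A \<in> Obj C \<Longrightarrow> \<sigma> \<I> A = \<one> A"
  using Sym_Sym[of "\<I>" A] by simp

lemma merge:
  assumes "f \<in> Arr C" "g \<in> Arr C" "h \<in> Arr C" "k \<in> Arr C" "Cod C f = Dom C h" "Cod C g = Dom C k"
  shows "(f \<otimes> g) \<cdot> (h \<otimes> k) = (f \<cdot> h) \<otimes> (g \<cdot> k)"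
  using TensorM_Comp[of f "Dom C f" "Dom C h" h "Cod C h" g "Dom C g" "Dom C k" k "Cod C k"] assms
  by simp

lemma merge_then:
  assumes "f \<in> Arr C" "g \<in> Arr C" "h \<in> Arr C" "k \<in> Arr C" "Cod C f = Dom C h" "Cod C g = Dom C k"
    "r \<in> Arr C" "Cod C h \<odot> Cod C k = Dom C r"
  shows "(f \<otimes> g) \<cdot> ((h \<otimes> k) \<cdot> r) = ((f \<cdot> h) \<otimes> (g \<cdot> k)) \<cdot> r"
  using assms by (simp add: merge flip: Comp_assoc')

text \<open>Tensors are nested to the right as well, so the cut between the two blocks can fall
  where the side conditions of \<open>merge\<close> fail. This rule and \<open>merge_left\<close>
  regroup one side first.\<close>

lemma merge_right:
  assumes "f \<in> Arr C" "g \<in> Arr C" "h \<in> Arr C" "h' \<in> Arr C" "k \<in> Arr C"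
    "Cod C f = Dom C h \<odot> Dom C h'" "Cod C g = Dom C k"
  shows "(f \<otimes> g) \<cdot> (h \<otimes> (h' \<otimes> k)) = (f \<cdot> (h \<otimes> h')) \<otimes> (g \<cdot> k)"
  using assms merge[of f g "h \<otimes> h'" k] by simp

lemma merge_right_then:
  assumes "f \<in> Arr C" "g \<in> Arr C" "h \<in> Arr C" "h' \<in> Arr C" "k \<in> Arr C"
    "Cod C f = Dom C h \<odot> Dom C h'" "Cod C g = Dom C k"
    "r \<in> Arr C" "Cod C h \<odot> (Cod C h' \<odot> Cod C k) = Dom C r"
  shows "(f \<otimes> g) \<cdot> ((h \<otimes> (h' \<otimes> k)) \<cdot> r) = ((f \<cdot> (h \<otimes> h')) \<otimes> (g \<cdot> k)) \<cdot> r"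
  using assms merge_then[of f g "h \<otimes> h'" k r] by simp

lemma merge_left:
  assumes "f \<in> Arr C" "f' \<in> Arr C" "g \<in> Arr C" "h \<in> Arr C" "k \<in> Arr C"
    "Cod C f \<odot> Cod C f' = Dom C h" "Cod C g = Dom C k"
  shows "(f \<otimes> (f' \<otimes> g)) \<cdot> (h \<otimes> k) = ((f \<otimes> f') \<cdot> h) \<otimes> (g \<cdot> k)"
  using assms merge[of "f \<otimes> f'" g h k] by simp

lemma merge_left_then:
  assumes "f \<in> Arr C" "f' \<in> Arr C" "g \<in> Arr C" "h \<in> Arr C" "k \<in> Arr C"
    "Cod C f \<odot> Cod C f' = Dom C h" "Cod C g = Dom C k"
    "r \<in> Arr C" "Cod C h \<odot> Cod C k = Dom C r"
  shows "(f \<otimes> (f' \<otimes> g)) \<cdot> ((h \<otimes> k) \<cdot> r) = (((f \<otimes> f') \<cdot> h) \<otimes> (g \<cdot> k)) \<cdot> r"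
  using assms merge_then[of "f \<otimes> f'" g h k r] by simp

lemmas merges = merge merge_then merge_right merge_right_then merge_left merge_left_then

lemma Sym_natural':
  assumes "f \<in> Arr C" "g \<in> Arr C" "Cod C f = Y" "Cod C g = Y'"
  shows "(f \<otimes> g) \<cdot> \<sigma> Y Y' = \<sigma> (Dom C f) (Dom C g) \<cdot> (g \<otimes> f)"
  using Sym_natural[of f "Dom C f" Y g "Dom C g" Y'] assms by simp

lemma middle_swap:
  assumes [simp]: "f \<in> Arr C" "f' \<in> Arr C" "g \<in> Arr C" "g' \<in> Arr C"
    "Dom C f = W" "Dom C f' = Y" "Dom C g = X" "Dom C g' = Z"
  shows "(\<one> W \<otimes> (\<sigma> X Y \<otimes> \<one> Z)) \<cdot> (f \<otimes> (f' \<otimes> (g \<otimes> g')))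
    = (f \<otimes> (g \<otimes> (f' \<otimes> g'))) \<cdot> (\<one> (Cod C f) \<otimes> (\<sigma> (Cod C g) (Cod C f') \<otimes> \<one> (Cod C g')))"
proof -
  have [simp]: "W \<in> Obj C" "X \<in> Obj C" "Y \<in> Obj C" "Z \<in> Obj C"
    using Dom_Obj assms by metis+
  show ?thesis
    by (simp add: merges Sym_natural')
qed

end

context additive_symmetric_monoidal_category
begin

lemma Plus_typing [simp]:
  assumes "f \<in> Arr C" "g \<in> Arr C" "Dom C f = Dom C g" "Cod C f = Cod C g"
  shows "f \<oplus> g \<in> Arr C" "Dom C (f \<oplus> g) = Dom C f" "Cod C (f \<oplus> g) = Cod C f"
  using Plus_hom[of f "Dom C f" "Cod C f" g] assms by simp_all

lemma Zero_typing [simp]: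
  assumes "X \<in> Obj C" "Y \<in> Obj C"
  shows "\<zero> X Y \<in> Arr C" "Dom C (\<zero> X Y) = X" "Cod C (\<zero> X Y) = Y"
  using Zero_hom[OF assms] by simp_all

lemma Zero_Comp' [simp]: "X \<in> Obj C \<Longrightarrow> f \<in> Arr C \<Longrightarrow> Dom C f = Y \<Longrightarrow> \<zero> X Y \<cdot> f = \<zero> X (Cod C f)"
  using Zero_Comp[of X f Y "Cod C f"] by simp

lemma Comp_Zero' [simp]: "Z \<in> Obj C \<Longrightarrow> f \<in> Arr C \<Longrightarrow> Cod C f = Y \<Longrightarrow> f \<cdot> \<zero> Y Z = \<zero> (Dom C f) Z"
  using Comp_Zero[of Z f "Dom C f" Y] by simp

lemma Tensor_Zero' [simp]:
  "X \<in> Obj C \<Longrightarrow> Y \<in> Obj C \<Longrightarrow> h \<in> Arr C \<Longrightarrow> h \<otimes> \<zero> X Y = \<zero> (Dom C h \<odot> X) (Cod C h \<odot> Y)"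
  using Tensor_Zero[of X Y h "Dom C h" "Cod C h"] by simp

lemma Plus_Zero' [simp]: "f \<in> Arr C \<Longrightarrow> Dom C f = X \<Longrightarrow> Cod C f = Y \<Longrightarrow> f \<oplus> \<zero> X Y = f"
  using Plus_Zero[of f X Y] by simp

lemma Zero_Plus' [simp]: "f \<in> Arr C \<Longrightarrow> Dom C f = X \<Longrightarrow> Cod C f = Y \<Longrightarrow> \<zero> X Y \<oplus> f = f"
  using Plus_comm[of f X Y "\<zero> X Y"] Dom_Obj[of f] Cod_Obj[of f] by simp

lemma Plus_Comp:
  assumes "f \<in> Arr C" "g \<in> Arr C" "Dom C f = Dom C g" "Cod C f = Cod C g" "h \<in> Arr C" "Cod C f = Dom C h"
  shows "(f \<oplus> g) \<cdot> h = f \<cdot> h \<oplus> g \<cdot> h"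
  using Comp_Plus[of "\<one> (Dom C f)" "Dom C f" "Dom C f" f "Cod C f" g h "Cod C h"] assms
  by simp

lemma Comp_Plus':
  assumes "f \<in> Arr C" "g \<in> Arr C" "Dom C f = Dom C g" "Cod C f = Cod C g" "h \<in> Arr C" "Cod C h = Dom C f"
  shows "h \<cdot> (f \<oplus> g) = h \<cdot> f \<oplus> h \<cdot> g"
  using Comp_Plus[of h "Dom C h" "Dom C f" f "Cod C f" g "\<one> (Cod C f)" "Cod C f"] assms
  by simp

lemma Plus_Tensor:
  assumes "f \<in> Arr C" "g \<in> Arr C" "Dom C f = Dom C g" "Cod C f = Cod C g" "h \<in> Arr C"
  shows "(f \<oplus> g) \<otimes> h = f \<otimes> h \<oplus> g \<otimes> h"
  using Tensor_Plus[of "\<one> \<I>" \<I> \<I> f "Dom C f" "Cod C f" g h "Dom C h" "Cod C h"] assms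
  by simp

lemmas distribs = Plus_Comp Comp_Plus' Plus_Tensor

end

section \<open>Coalgebras of the modality\<close>

context coalgebra_modality
begin

lemma Bang_Obj [simp]: "A \<in> Obj C \<Longrightarrow> \<B> A \<in> Obj C"
  using Bang_functor by (simp add: endofunctor_def)

lemma Bang_typing [simp]:
  assumes "f \<in> Arr C"
  shows "\<M> f \<in> Arr C" "Dom C (\<M> f) = \<B> (Dom C f)" "Cod C (\<M> f) = \<B> (Cod C f)"
  using Bang_functor assms by (simp_all add: endofunctor_def)

lemma Bang_Id [simp]: "A \<in> Obj C \<Longrightarrow> \<M> (\<one> A) = \<one> (\<B> A)"
  using Bang_functor by (simp add: endofunctor_def)

lemma Bang_Comp: "f \<in> Arr C \<Longrightarrow> g \<in> Arr C \<Longrightarrow> Cod C f = Dom C g \<Longrightarrow> \<M> (f \<cdot> g) = \<M> f \<cdot> \<M> g"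
  using Bang_functor by (simp add: endofunctor_def)

lemma structure_typing [simp]:
  assumes "A \<in> Obj C"
  shows "\<delta> A \<in> Arr C" "Dom C (\<delta> A) = \<B> A" "Cod C (\<delta> A) = \<B> (\<B> A)"
    and "\<epsilon> A \<in> Arr C" "Dom C (\<epsilon> A) = \<B> A" "Cod C (\<epsilon> A) = A"
    and "\<Delta> A \<in> Arr C" "Dom C (\<Delta> A) = \<B> A" "Cod C (\<Delta> A) = \<B> A \<odot> \<B> A"
    and "\<e> A \<in> Arr C" "Dom C (\<e> A) = \<B> A" "Cod C (\<e> A) = \<I>"
  using Delta_natural Epsilon_natural Comult_natural Counit_natural assms
  by (simp_all add: natural_transformation_def)

lemma naturality:
  assumes "f \<in> Arr C" "Cod C f = Y"
  shows Epsilon_nat: "\<M> f \<cdot> \<epsilon> Y = \<epsilon> (Dom C f) \<cdot> f"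
    and Comult_nat: "\<M> f \<cdot> \<Delta> Y = \<Delta> (Dom C f) \<cdot> (\<M> f \<otimes> \<M> f)"
  using Epsilon_natural Comult_natural assms
  by (auto simp: natural_transformation_def)

lemma coderiving_typing [simp]:
  assumes "A \<in> Obj C"
  shows "\<d> A \<in> Arr C" "Dom C (\<d> A) = \<B> A" "Cod C (\<d> A) = \<B> A \<odot> A"
  using assms by (simp_all add: coderiving_def)

lemma coderiving_nat:
  assumes "f \<in> Arr C" "Cod C f = Y"
  shows "\<M> f \<cdot> \<d> Y = \<d> (Dom C f) \<cdot> (\<M> f \<otimes> f)"
  using assms Dom_Obj[of f] Cod_Obj[of f]
  by (auto simp add: coderiving_def naturality naturality[THEN comp_then] merges)

text \<open>A !-coalgebra \<open>P\<close> inherits the comultiplication \<open>p \<cdot> \<Delta> P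
  \<cdot> (\<epsilon> P \<otimes> \<epsilon> P)\<close>, and by the first identity \<open>p\<close>
  preserves it: naturality rewrites \<open>\<epsilon> P \<cdot> p\<close> as
  \<open>\<M> p \<cdot> \<epsilon> (\<B> P)\<close>, \<open>coassoc\<close> trades
  \<open>p \<cdot> \<M> p\<close> for \<open>p \<cdot> \<delta> P\<close>, and \<delta> preserves
  \<Delta>. The others are laws for the half-lifted comultiplication
  \<open>p \<cdot> \<d> P\<close>.\<close>

lemma coalgebra_Comult_lift:
  assumes [simp]: "P \<in> Obj C" "p \<in> Arr C" "Dom C p = P" "Cod C p = \<B> P"
    and counit: "p \<cdot> \<epsilon> P = \<one> P" and coassoc: "p \<cdot> \<delta> P = p \<cdot> \<M> p"
  shows "p \<cdot> \<Delta> P \<cdot> ((\<epsilon> P \<cdot> p) \<otimes> (\<epsilon> P \<cdot> p)) = p \<cdot> \<Delta> P"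
    and "p \<cdot> \<d> P \<cdot> (\<one> (\<B> P) \<otimes> p) = p \<cdot> \<Delta> P"
    and "p \<cdot> \<d> P \<cdot> (\<Delta> P \<otimes> \<one> P) = p \<cdot> \<d> P \<cdot> (\<one> (\<B> P) \<otimes> (p \<cdot> \<d> P))"
    and "p \<cdot> \<d> P \<cdot> (\<delta> P \<otimes> \<one> P) = p \<cdot> \<d> P \<cdot> (\<M> p \<otimes> \<one> P)"
proof -
  show 1: "p \<cdot> \<Delta> P \<cdot> ((\<epsilon> P \<cdot> p) \<otimes> (\<epsilon> P \<cdot> p)) = p \<cdot> \<Delta> P"
  proof -
    have "p \<cdot> \<Delta> P \<cdot> ((\<epsilon> P \<cdot> p) \<otimes> (\<epsilon> P \<cdot> p)) = (p \<cdot> \<M> p) \<cdot> \<Delta> (\<B> P) \<cdot> (\<epsilon> (\<B> P) \<otimes> \<epsilon> (\<B> P))"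
      by (simp add: naturality naturality[THEN comp_then] merges)
    also have "\<dots> = p \<cdot> \<Delta> P"
      by (simp add: Delta_Comult[THEN comp_then] merges Delta_Epsilon flip: coassoc)
    finally show ?thesis .
  qed
  show 2: "p \<cdot> \<d> P \<cdot> (\<one> (\<B> P) \<otimes> p) = p \<cdot> \<Delta> P"
  proof -
    \<comment> \<open>By \<open>counit\<close>, \<open>\<epsilon> P \<cdot> p\<close> is idempotent,
      so applying it to the second leg once more changes nothing.\<close>
    have "p \<cdot> \<Delta> P \<cdot> (\<one> (\<B> P) \<otimes> (\<epsilon> P \<cdot> p)) = (p \<cdot> \<Delta> P \<cdot> ((\<epsilon> P \<cdot> p) \<otimes> (\<epsilon> P \<cdot> p))) \<cdot> (\<one> (\<B> P) \<otimes> (\<epsilon> P \<cdot> p))"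
      by (simp only: 1)
    also have "\<dots> = p \<cdot> \<Delta> P \<cdot> ((\<epsilon> P \<cdot> p) \<otimes> (\<epsilon> P \<cdot> p))"
      by (simp add: merges counit[THEN comp_then])
    finally show ?thesis
      by (simp add: 1[simplified] coderiving_def merges)
  qed
  show "p \<cdot> \<d> P \<cdot> (\<Delta> P \<otimes> \<one> P) = p \<cdot> \<d> P \<cdot> (\<one> (\<B> P) \<otimes> (p \<cdot> \<d> P))"
  proof -
    have "p \<cdot> \<d> P \<cdot> (\<Delta> P \<otimes> \<one> P) = p \<cdot> (\<Delta> P \<cdot> (\<Delta> P \<otimes> \<one> (\<B> P))) \<cdot> (\<one> (\<B> P) \<otimes> (\<one> (\<B> P) \<otimes> \<epsilon> P))"
      by (simp add: coderiving_def merges)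
    also have "\<dots> = (p \<cdot> \<Delta> P) \<cdot> (\<one> (\<B> P) \<otimes> \<d> P)"
      by (simp add: coderiving_def merges Comult_assoc)
    also have "\<dots> = p \<cdot> \<d> P \<cdot> (\<one> (\<B> P) \<otimes> (p \<cdot> \<d> P))"
      by (simp add: merges flip: 2)
    finally show ?thesis .
  qed
  show "p \<cdot> \<d> P \<cdot> (\<delta> P \<otimes> \<one> P) = p \<cdot> \<d> P \<cdot> (\<M> p \<otimes> \<one> P)"
  proof -
    have "p \<cdot> \<d> P \<cdot> (\<delta> P \<otimes> \<one> P) = p \<cdot> (\<Delta> P \<cdot> (\<delta> P \<otimes> \<delta> P)) \<cdot> (\<one> (\<B> (\<B> P)) \<otimes> (\<epsilon> (\<B> P) \<cdot> \<epsilon> P))"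
      by (simp add: coderiving_def merges Delta_Epsilon[THEN comp_then])
    also have "\<dots> = (p \<cdot> \<delta> P) \<cdot> \<Delta> (\<B> P) \<cdot> (\<one> (\<B> (\<B> P)) \<otimes> (\<epsilon> (\<B> P) \<cdot> \<epsilon> P))"
      by (simp flip: Delta_Comult)
    also have "\<dots> = p \<cdot> \<d> P \<cdot> (\<M> p \<otimes> \<one> P)"
      by (simp add: coassoc naturality naturality[THEN comp_then] merges coderiving_def counit)
    finally show ?thesis .
  qed
qed

end

section \<open>The chain rule on a tensor product of cofree coalgebras\<close>

context deriving_transformation
begin

lemma d_typing [simp]:
  assumes "A \<in> Obj C"
  shows "d A \<in> Arr C" "Dom C (d A) = \<B> A \<odot> A" "Cod C (d A) = \<B> A"
  using d_natural assms by (simp_all add: natural_transformation_def)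

lemma d_nat: "f \<in> Arr C \<Longrightarrow> Cod C f = Y \<Longrightarrow> (\<M> f \<otimes> f) \<cdot> d Y = d (Dom C f) \<cdot> \<M> f"
  using d_natural by (auto simp: natural_transformation_def)

end

text \<open>\<open>b\<close> is read as a vector field on the coalgebra \<open>P\<close> with
  directions in \<open>D\<close>. The chain rule along \<open>b\<close> is to be proved for the
  instance in \<open>d_monoidal\<close>, so it is not among the assumptions.\<close>

locale coalgebra_with_vector_field = deriving_transformation C d
  for C :: "('o, 'm, 'x) coalg_cat_scheme" (structure) and d :: "'o \<Rightarrow> 'm" +
  fixes P D :: 'o and p b :: 'm
  assumes P_Obj [simp]: "P \<in> Obj C" and D_Obj [simp]: "D \<in> Obj C"
    and p_hom: "p \<in> Hom P (\<B> P)" and b_hom: "b \<in> Hom (P \<odot> D) P"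
    and counit: "p \<cdot> \<epsilon> P = \<one> P" and coassoc: "p \<cdot> \<delta> P = p \<cdot> \<M> p"
begin

lemma pb_typing [simp]:
  "p \<in> Arr C" "Dom C p = P" "Cod C p = \<B> P" "b \<in> Arr C" "Dom C b = P \<odot> D" "Cod C b = P"
  using p_hom b_hom by simp_all

text \<open>The comultiplication inherited by \<open>P\<close>, with its first leg kept in
  \<open>\<B> P\<close> so that \<open>d P\<close> can be applied there.\<close>

definition q where "q = p \<cdot> \<d> P"

text \<open>
  The value \<open>b \<cdot> p\<close> must have if \<open>p\<close> obeys the chain rule along \<open>b\<close>.
\<close>

definition lift where "lift = (q \<otimes> \<one> D) \<cdot> (\<one> (\<B> P) \<otimes> b) \<cdot> d P"

lemma q_typing [simp]: "q \<in> Arr C" "Dom C q = P" "Cod C q = \<B> P \<odot> P"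
  by (simp_all add: q_def)

lemma lift_typing [simp]: "lift \<in> Arr C" "Dom C lift = P \<odot> D" "Cod C lift = \<B> P"
  by (simp_all add: lift_def)

lemma q_p: "q \<cdot> (\<one> (\<B> P) \<otimes> p) = p \<cdot> \<Delta> P"
  and q_Comult: "q \<cdot> (\<Delta> P \<otimes> \<one> P) = q \<cdot> (\<one> (\<B> P) \<otimes> q)"
  and q_Delta: "q \<cdot> (\<delta> P \<otimes> \<one> P) = q \<cdot> (\<M> p \<otimes> \<one> P)"
  unfolding q_def by (rule coalgebra_Comult_lift; simp add: counit coassoc)+

lemma b_Comult: "(\<one> (\<B> P) \<otimes> b) \<cdot> (\<Delta> P \<otimes> \<one> P) = (\<Delta> P \<otimes> \<one> P \<otimes> \<one> D) \<cdot> (\<one> (\<B> P) \<otimes> \<one> (\<B> P) \<otimes> b)"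
  by (simp add: merges)

text \<open>\<open>d_chain\<close> puts an extra \<Delta> and \<delta> on the first leg of
  \<open>q\<close>. By \<open>q_Comult\<close> the former becomes a second \<open>q\<close>, which
  completes an inner \<open>lift\<close>; by \<open>q_Delta\<close> the latter becomes
  \<open>\<M> p\<close>.\<close>

lemma lift_Delta: "lift \<cdot> \<delta> P = (q \<otimes> \<one> D) \<cdot> (\<M> p \<otimes> lift) \<cdot> d (\<B> P)"
proof -
  have "lift \<cdot> \<delta> P = (q \<otimes> \<one> D) \<cdot> (\<Delta> P \<otimes> \<one> P \<otimes> \<one> D)
      \<cdot> ((\<one> (\<B> P) \<otimes> \<one> (\<B> P) \<otimes> b) \<cdot> (\<delta> P \<otimes> \<one> (\<B> P) \<otimes> \<one> P) \<cdot> (\<one> (\<B> (\<B> P)) \<otimes> d P)) \<cdot> d (\<B> P)"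
    by (simp add: lift_def d_chain b_Comult[simplified, THEN comp_then])
  also have "(\<one> (\<B> P) \<otimes> \<one> (\<B> P) \<otimes> b) \<cdot> (\<delta> P \<otimes> \<one> (\<B> P) \<otimes> \<one> P) \<cdot> (\<one> (\<B> (\<B> P)) \<otimes> d P)
      = \<delta> P \<otimes> ((\<one> (\<B> P) \<otimes> b) \<cdot> d P)"
    by (simp add: merges)
  also have "(q \<otimes> \<one> D) \<cdot> (\<Delta> P \<otimes> \<one> P \<otimes> \<one> D) \<cdot> (\<delta> P \<otimes> ((\<one> (\<B> P) \<otimes> b) \<cdot> d P)) \<cdot> d (\<B> P)
      = ((q \<cdot> (\<Delta> P \<otimes> \<one> P)) \<otimes> \<one> D) \<cdot> (\<delta> P \<otimes> ((\<one> (\<B> P) \<otimes> b) \<cdot> d P)) \<cdot> d (\<B> P)"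
    by (simp add: merge_right_then merge)
  also have "\<dots> = (q \<otimes> \<one> D) \<cdot> ((\<one> (\<B> P) \<otimes> q \<otimes> \<one> D) \<cdot> (\<delta> P \<otimes> ((\<one> (\<B> P) \<otimes> b) \<cdot> d P))) \<cdot> d (\<B> P)"
    by (simp add: q_Comult merge_right_then)
  also have "(\<one> (\<B> P) \<otimes> q \<otimes> \<one> D) \<cdot> (\<delta> P \<otimes> ((\<one> (\<B> P) \<otimes> b) \<cdot> d P))
      = (\<delta> P \<otimes> \<one> P \<otimes> \<one> D) \<cdot> (\<one> (\<B> (\<B> P)) \<otimes> lift)"
    by (simp add: lift_def merges)
  also have "(q \<otimes> \<one> D) \<cdot> ((\<delta> P \<otimes> \<one> P \<otimes> \<one> D) \<cdot> (\<one> (\<B> (\<B> P)) \<otimes> lift)) \<cdot> d (\<B> P)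
      = (q \<otimes> \<one> D) \<cdot> ((\<M> p \<otimes> \<one> P \<otimes> \<one> D) \<cdot> (\<one> (\<B> (\<B> P)) \<otimes> lift)) \<cdot> d (\<B> P)"
    by (simp add: q_Delta merge_right_then)
  also have "(\<M> p \<otimes> \<one> P \<otimes> \<one> D) \<cdot> (\<one> (\<B> (\<B> P)) \<otimes> lift) = \<M> p \<otimes> lift"
    by (simp add: merges)
  finally show ?thesis .
qed

text \<open>Product rule along \<open>b\<close>: since \<open>x\<close> is constant along
  \<open>b\<close>, only the summand differentiating the \<open>y\<close> leg survives, and
  \<open>q_Comult\<close> supplies the second \<open>q\<close> needed to see \<open>lift\<close>
  there.\<close>

lemma lift_Comult:
  assumes [simp]: "x \<in> Arr C" "Dom C x = P" "y \<in> Arr C" "Dom C y = P"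
    and const: "b \<cdot> x = \<zero> (P \<odot> D) (Cod C x)"
  shows "lift \<cdot> \<Delta> P \<cdot> (\<M> x \<otimes> \<M> y) = (q \<otimes> \<one> D) \<cdot> (\<M> x \<otimes> (lift \<cdot> \<M> y))"
proof -
  have [simp]: "Cod C x \<in> Obj C" "Cod C y \<in> Obj C" by simp_all
  let ?S = "(q \<otimes> \<one> D) \<cdot> (\<one> (\<B> P) \<otimes> b) \<cdot> (\<Delta> P \<otimes> \<one> P)"
  have "lift \<cdot> \<Delta> P \<cdot> (\<M> x \<otimes> \<M> y)
    = ?S \<cdot> (\<one> (\<B> P) \<otimes> \<sigma> (\<B> P) P) \<cdot> (d P \<otimes> \<one> (\<B> P)) \<cdot> (\<M> x \<otimes> \<M> y)
      \<oplus> ?S \<cdot> (\<one> (\<B> P) \<otimes> d P) \<cdot> (\<M> x \<otimes> \<M> y)"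
    by (simp add: lift_def d_product distribs)
  also have "?S \<cdot> (\<one> (\<B> P) \<otimes> \<sigma> (\<B> P) P) \<cdot> (d P \<otimes> \<one> (\<B> P)) \<cdot> (\<M> x \<otimes> \<M> y)
    = \<zero> (P \<odot> D) (\<B> (Cod C x) \<odot> \<B> (Cod C y))"
  proof -
    \<comment> \<open>Naturality of \<open>d\<close> has turned \<open>\<M> x\<close> into
      \<open>\<M> x \<otimes> x\<close> in front of \<open>d\<close>; moving \<sigma> past it brings
      \<open>x\<close> directly behind \<open>b\<close>, where \<open>const\<close> gives
      zero.\<close>
    let ?R = "(\<one> (\<B> P) \<otimes> \<one> (\<B> P) \<otimes> b) \<cdot> (\<one> (\<B> P) \<otimes> \<sigma> (\<B> P) P) \<cdot> (\<M> x \<otimes> x \<otimes> \<M> y)"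
    have "\<sigma> (\<B> P) P \<cdot> (x \<otimes> \<M> y) = (\<M> y \<otimes> x) \<cdot> \<sigma> (\<B> (Cod C y)) (Cod C x)"
      by (simp add: Sym_natural')
    then have "?R = (\<M> x \<otimes> \<M> y \<otimes> (b \<cdot> x)) \<cdot> (\<one> (\<B> (Cod C x)) \<otimes> \<sigma> (\<B> (Cod C y)) (Cod C x))"
      by (simp add: merges)
    then have "?R = \<zero> (\<B> P \<odot> \<B> P \<odot> P \<odot> D) (\<B> (Cod C x) \<odot> Cod C x \<odot> \<B> (Cod C y))"
      by (simp add: const)
    moreover have "(d P \<otimes> \<one> (\<B> P)) \<cdot> (\<M> x \<otimes> \<M> y)
      = (\<M> x \<otimes> x \<otimes> \<M> y) \<cdot> (d (Cod C x) \<otimes> \<one> (\<B> (Cod C y)))"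
      by (simp add: merges d_nat)
    then have "?S \<cdot> (\<one> (\<B> P) \<otimes> \<sigma> (\<B> P) P) \<cdot> (d P \<otimes> \<one> (\<B> P)) \<cdot> (\<M> x \<otimes> \<M> y)
      = (q \<otimes> \<one> D) \<cdot> (\<Delta> P \<otimes> \<one> P \<otimes> \<one> D) \<cdot> ?R \<cdot> (d (Cod C x) \<otimes> \<one> (\<B> (Cod C y)))"
      by (simp add: b_Comult[simplified, THEN comp_then])
    ultimately show ?thesis
      by (simp only:) simp
  qed
  also have "?S \<cdot> (\<one> (\<B> P) \<otimes> d P) \<cdot> (\<M> x \<otimes> \<M> y) = (q \<otimes> \<one> D) \<cdot> (\<Delta> P \<otimes> \<one> P \<otimes> \<one> D)
      \<cdot> ((\<one> (\<B> P) \<otimes> \<one> (\<B> P) \<otimes> b) \<cdot> (\<one> (\<B> P) \<otimes> d P) \<cdot> (\<M> x \<otimes> \<M> y))"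
    by (simp add: b_Comult[simplified, THEN comp_then])
  also have "(\<one> (\<B> P) \<otimes> \<one> (\<B> P) \<otimes> b) \<cdot> (\<one> (\<B> P) \<otimes> d P) \<cdot> (\<M> x \<otimes> \<M> y)
      = \<M> x \<otimes> ((\<one> (\<B> P) \<otimes> b) \<cdot> d P \<cdot> \<M> y)"
    by (simp add: merges)
  also have "(q \<otimes> \<one> D) \<cdot> (\<Delta> P \<otimes> \<one> P \<otimes> \<one> D) \<cdot> (\<M> x \<otimes> ((\<one> (\<B> P) \<otimes> b) \<cdot> d P \<cdot> \<M> y))
    = ((q \<cdot> (\<Delta> P \<otimes> \<one> P)) \<otimes> \<one> D) \<cdot> (\<M> x \<otimes> ((\<one> (\<B> P) \<otimes> b) \<cdot> d P \<cdot> \<M> y))"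
    by (simp add: merge_right_then)
  also have "\<dots> = (q \<otimes> \<one> D) \<cdot> ((\<one> (\<B> P) \<otimes> q \<otimes> \<one> D) \<cdot> (\<M> x \<otimes> ((\<one> (\<B> P) \<otimes> b) \<cdot> d P \<cdot> \<M> y)))"
    by (simp add: q_Comult merge_right_then)
  also have "(\<one> (\<B> P) \<otimes> q \<otimes> \<one> D) \<cdot> (\<M> x \<otimes> ((\<one> (\<B> P) \<otimes> b) \<cdot> d P \<cdot> \<M> y)) = \<M> x \<otimes> (lift \<cdot> \<M> y)"
    by (simp add: lift_def merges)
  finally show ?thesis by simp
qed

end

section \<open>Monoidality of the coderiving transformation and tensor products of cofree
  coalgebras\<close>

context monoidal_coalgebra_modality
begin

lemma m_typing [simp]:
  assumes "A \<in> Obj C" "B \<in> Obj C"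
  shows "m A B \<in> Arr C" "Dom C (m A B) = \<B> A \<odot> \<B> B" "Cod C (m A B) = \<B> (A \<odot> B)"
  using m_hom[OF assms] by simp_all

lemma mI_typing [simp]: "m\<^sub>I \<in> Arr C" "Dom C m\<^sub>I = \<I>" "Cod C m\<^sub>I = \<B> \<I>"
  using mI_hom by simp_all

lemma m_nat:
  "f \<in> Arr C \<Longrightarrow> g \<in> Arr C \<Longrightarrow> Cod C f = Y \<Longrightarrow> Cod C g = Y'
    \<Longrightarrow> (\<M> f \<otimes> \<M> g) \<cdot> m Y Y' = m (Dom C f) (Dom C g) \<cdot> \<M> (f \<otimes> g)"
  using m_natural by auto

lemma m_coderiving:
  assumes [simp]: "A \<in> Obj C" "B \<in> Obj C"
  shows "m A B \<cdot> \<d> (A \<odot> B)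
    = (\<d> A \<otimes> \<d> B) \<cdot> (\<one> (\<B> A) \<otimes> \<sigma> A (\<B> B) \<otimes> \<one> B) \<cdot> (m A B \<otimes> \<one> A \<otimes> \<one> B)"
proof -
  have "m A B \<cdot> \<d> (A \<odot> B) = (\<Delta> A \<otimes> \<Delta> B)
      \<cdot> (\<one> (\<B> A) \<otimes> \<sigma> (\<B> A) (\<B> B) \<otimes> \<one> (\<B> B)) \<cdot> (m A B \<otimes> (\<epsilon> A \<otimes> \<epsilon> B))"
    by (simp add: coderiving_def m_Comult[THEN comp_then] merges m_Epsilon)
  also have "m A B \<otimes> (\<epsilon> A \<otimes> \<epsilon> B) = (\<one> (\<B> A) \<otimes> \<one> (\<B> B) \<otimes> \<epsilon> A \<otimes> \<epsilon> B) \<cdot> (m A B \<otimes> \<one> A \<otimes> \<one> B)"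
    by (simp add: merges)
  also have "(\<Delta> A \<otimes> \<Delta> B) \<cdot> (\<one> (\<B> A) \<otimes> \<sigma> (\<B> A) (\<B> B) \<otimes> \<one> (\<B> B))
      \<cdot> ((\<one> (\<B> A) \<otimes> \<one> (\<B> B) \<otimes> \<epsilon> A \<otimes> \<epsilon> B) \<cdot> (m A B \<otimes> \<one> A \<otimes> \<one> B)) = (\<Delta> A \<otimes> \<Delta> B)
      \<cdot> ((\<one> (\<B> A) \<otimes> \<sigma> (\<B> A) (\<B> B) \<otimes> \<one> (\<B> B)) \<cdot> (\<one> (\<B> A) \<otimes> \<one> (\<B> B) \<otimes> \<epsilon> A \<otimes> \<epsilon> B))
      \<cdot> (m A B \<otimes> \<one> A \<otimes> \<one> B)"
    by simp
  also have "(\<one> (\<B> A) \<otimes> \<sigma> (\<B> A) (\<B> B) \<otimes> \<one> (\<B> B)) \<cdot> (\<one> (\<B> A) \<otimes> \<one> (\<B> B) \<otimes> \<epsilon> A \<otimes> \<epsilon> B)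
    = (\<one> (\<B> A) \<otimes> \<epsilon> A \<otimes> \<one> (\<B> B) \<otimes> \<epsilon> B) \<cdot> (\<one> (\<B> A) \<otimes> \<sigma> A (\<B> B) \<otimes> \<one> B)"
    by (simp add: middle_swap)
  finally show ?thesis
    by (simp add: coderiving_def merge_right_then)
qed

text \<open>The structure map of the tensor product of the cofree !-coalgebras on \<open>A\<close>
  and \<open>B\<close>.\<close>

definition tensor_coalgebra where
  "tensor_coalgebra A B = (\<delta> A \<otimes> \<delta> B) \<cdot> m (\<B> A) (\<B> B)"

lemma tensor_coalgebra_typing [simp]:
  assumes "A \<in> Obj C" "B \<in> Obj C"
  shows "tensor_coalgebra A B \<in> Arr C" "Dom C (tensor_coalgebra A B) = \<B> A \<odot> \<B> B"
    "Cod C (tensor_coalgebra A B) = \<B> (\<B> A \<odot> \<B> B)"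
  using assms by (simp_all add: tensor_coalgebra_def)

text \<open>The first two identities supply the assumptions of
  \<open>coalgebra_with_vector_field\<close>; the third identifies the inherited comultiplication
  with the usual one on a tensor product of comonoids.\<close>

lemma tensor_coalgebra:
  assumes [simp]: "A \<in> Obj C" "B \<in> Obj C"
  shows tensor_coalgebra_counit:
      "tensor_coalgebra A B \<cdot> \<epsilon> (\<B> A \<odot> \<B> B) = \<one> (\<B> A \<odot> \<B> B)"
    and tensor_coalgebra_coassoc:
      "tensor_coalgebra A B \<cdot> \<delta> (\<B> A \<odot> \<B> B) = tensor_coalgebra A B \<cdot> \<M> (tensor_coalgebra A B)"
    and tensor_coalgebra_Comult: "tensor_coalgebra A B \<cdot> \<Delta> (\<B> A \<odot> \<B> B)
      = (\<Delta> A \<otimes> \<Delta> B) \<cdot> (\<one> (\<B> A) \<otimes> \<sigma> (\<B> A) (\<B> B) \<otimes> \<one> (\<B> B))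
        \<cdot> (tensor_coalgebra A B \<otimes> tensor_coalgebra A B)"
proof -
  show "tensor_coalgebra A B \<cdot> \<epsilon> (\<B> A \<odot> \<B> B) = \<one> (\<B> A \<odot> \<B> B)"
    by (simp add: tensor_coalgebra_def m_Epsilon merges Delta_Epsilon)
  show "tensor_coalgebra A B \<cdot> \<delta> (\<B> A \<odot> \<B> B) = tensor_coalgebra A B \<cdot> \<M> (tensor_coalgebra A B)"
  proof -
    have "m (\<B> A) (\<B> B) \<cdot> \<M> (\<delta> A \<otimes> \<delta> B) = (\<M> (\<delta> A) \<otimes> \<M> (\<delta> B)) \<cdot> m (\<B> (\<B> A)) (\<B> (\<B> B))"
      by (simp add: m_nat)
    from this[THEN comp_then] show ?thesis
      by (simp add: tensor_coalgebra_def m_Delta merges Delta_Delta Bang_Comp)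
  qed
  have "tensor_coalgebra A B \<cdot> \<Delta> (\<B> A \<odot> \<B> B) = ((\<Delta> A \<cdot> (\<delta> A \<otimes> \<delta> A)) \<otimes> (\<Delta> B \<cdot> (\<delta> B \<otimes> \<delta> B)))
      \<cdot> (\<one> (\<B> (\<B> A)) \<otimes> \<sigma> (\<B> (\<B> A)) (\<B> (\<B> B)) \<otimes> \<one> (\<B> (\<B> B))) \<cdot> (m (\<B> A) (\<B> B) \<otimes> m (\<B> A) (\<B> B))"
    by (simp add: tensor_coalgebra_def m_Comult[THEN comp_then] m_Comult merge_then flip: Delta_Comult)
  also have "\<dots> = (\<Delta> A \<otimes> \<Delta> B)
      \<cdot> ((\<one> (\<B> A) \<otimes> \<sigma> (\<B> A) (\<B> B) \<otimes> \<one> (\<B> B)) \<cdot> (\<delta> A \<otimes> \<delta> B \<otimes> \<delta> A \<otimes> \<delta> B))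
      \<cdot> (m (\<B> A) (\<B> B) \<otimes> m (\<B> A) (\<B> B))"
    by (simp add: middle_swap[THEN comp_then] merge_right_then)
  moreover have "(\<delta> A \<otimes> \<delta> B \<otimes> \<delta> A \<otimes> \<delta> B) \<cdot> (m (\<B> A) (\<B> B) \<otimes> m (\<B> A) (\<B> B))
      = tensor_coalgebra A B \<otimes> tensor_coalgebra A B"
    by (simp add: tensor_coalgebra_def merges)
  ultimately show "tensor_coalgebra A B \<cdot> \<Delta> (\<B> A \<odot> \<B> B)
      = (\<Delta> A \<otimes> \<Delta> B) \<cdot> (\<one> (\<B> A) \<otimes> \<sigma> (\<B> A) (\<B> B) \<otimes> \<one> (\<B> B))
        \<cdot> (tensor_coalgebra A B \<otimes> tensor_coalgebra A B)"
    by simp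
qed

end

section \<open>Differentiating \<open>m\<close> in its second variable\<close>

locale monoidal_differential = monoidal_coalgebra_modality C m m\<^sub>I + deriving_transformation C d
  for C :: "('o, 'm, 'x) coalg_cat_scheme" (structure)
    and m :: "'o \<Rightarrow> 'o \<Rightarrow> 'm" and m\<^sub>I :: "'m" and d :: "'o \<Rightarrow> 'm"
begin

text \<open>The chain rule \<open>b \<cdot> p = lift\<close> on the tensor coalgebra is proved
  first, by comparing components. Following it with
  \<open>\<M> (\<epsilon> B \<otimes> \<epsilon> A)\<close> cancels both \<delta> and leaves the
  claim.\<close>

lemma d_monoidal:
  assumes [simp]: "A \<in> Obj C" "B \<in> Obj C"
  shows "(\<one> (\<B> B) \<otimes> d A) \<cdot> m B A = (\<d> B \<otimes> \<one> (\<B> A) \<otimes> \<one> A)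
    \<cdot> (\<one> (\<B> B) \<otimes> \<sigma> B (\<B> A) \<otimes> \<one> A) \<cdot> (m B A \<otimes> \<one> B \<otimes> \<one> A) \<cdot> d (B \<odot> A)"
proof -
  define P where "P = \<B> B \<odot> \<B> A"
  define p where "p = tensor_coalgebra B A"
  define b where "b = \<one> (\<B> B) \<otimes> d A"
  \<comment> \<open>\<open>x\<close> and \<open>y\<close> are the projections of \<open>P\<close>
    onto its factors. As \<e> is a morphism of !-coalgebras, so are they: \<open>p_x\<close> and
    \<open>p_y\<close> say \<open>p \<cdot> \<M> x = x \<cdot> \<delta> B\<close> and
    \<open>p \<cdot> \<M> y = y \<cdot> \<delta> A\<close>.\<close>
  define x where "x = \<one> (\<B> B) \<otimes> \<e> A"
  define y where "y = \<e> B \<otimes> \<one> (\<B> A)"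
  interpret coalgebra_with_vector_field C d P A p b
    by unfold_locales
      (simp_all add: P_def p_def b_def tensor_coalgebra_counit tensor_coalgebra_coassoc)
  have xy [simp]: "x \<in> Arr C" "Dom C x = P" "Cod C x = \<B> B" "y \<in> Arr C" "Dom C y = P" "Cod C y = \<B> A"
    by (simp_all add: x_def y_def P_def)
  have p_x: "p \<cdot> \<M> x = \<delta> B \<otimes> \<e> A"
  proof -
    have "p \<cdot> \<M> x = (\<delta> B \<otimes> \<delta> A) \<cdot> (m (\<B> B) (\<B> A) \<cdot> \<M> (\<one> (\<B> B) \<otimes> \<e> A))"
      by (simp add: p_def x_def tensor_coalgebra_def)
    also have "m (\<B> B) (\<B> A) \<cdot> \<M> (\<one> (\<B> B) \<otimes> \<e> A) = (\<one> (\<B> (\<B> B)) \<otimes> \<M> (\<e> A)) \<cdot> m (\<B> B) \<I>"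
      using m_nat[of "\<one> (\<B> B)" "\<e> A" "\<B> B" "\<I>"] by simp
    also have "(\<delta> B \<otimes> \<delta> A) \<cdot> ((\<one> (\<B> (\<B> B)) \<otimes> \<M> (\<e> A)) \<cdot> m (\<B> B) \<I>)
        = (\<delta> B \<otimes> (\<delta> A \<cdot> \<M> (\<e> A))) \<cdot> m (\<B> B) \<I>"
      by (simp add: merges)
    also have "\<delta> B \<otimes> (\<delta> A \<cdot> \<M> (\<e> A)) = (\<delta> B \<otimes> \<e> A) \<cdot> (\<one> (\<B> (\<B> B)) \<otimes> m\<^sub>I)"
      using merge[of "\<delta> B" "\<e> A" "\<one> (\<B> (\<B> B))" "m\<^sub>I"] by (simp add: Delta_Bang_Counit)
    finally show ?thesis
      by (simp add: m_unit_right)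
  qed
  have p_y: "p \<cdot> \<M> y = \<e> B \<otimes> \<delta> A"
  proof -
    have "p \<cdot> \<M> y = (\<delta> B \<otimes> \<delta> A) \<cdot> (m (\<B> B) (\<B> A) \<cdot> \<M> (\<e> B \<otimes> \<one> (\<B> A)))"
      by (simp add: p_def y_def tensor_coalgebra_def)
    also have "m (\<B> B) (\<B> A) \<cdot> \<M> (\<e> B \<otimes> \<one> (\<B> A)) = (\<M> (\<e> B) \<otimes> \<one> (\<B> (\<B> A))) \<cdot> m \<I> (\<B> A)"
      using m_nat[of "\<e> B" "\<one> (\<B> A)" "\<I>" "\<B> A"] by simp
    also have "(\<delta> B \<otimes> \<delta> A) \<cdot> ((\<M> (\<e> B) \<otimes> \<one> (\<B> (\<B> A))) \<cdot> m \<I> (\<B> A))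
        = ((\<delta> B \<cdot> \<M> (\<e> B)) \<otimes> \<delta> A) \<cdot> m \<I> (\<B> A)"
      by (simp add: merges)
    also have "(\<delta> B \<cdot> \<M> (\<e> B)) \<otimes> \<delta> A = (\<e> B \<otimes> \<delta> A) \<cdot> (m\<^sub>I \<otimes> \<one> (\<B> (\<B> A)))"
      using merge[of "\<e> B" "\<delta> A" "m\<^sub>I" "\<one> (\<B> (\<B> A))"] by (simp add: Delta_Bang_Counit)
    finally show ?thesis
      by (simp add: m_unit_left)
  qed
  \<comment> \<open>Each projection discards one of the two copies of each factor, and the counit
    laws remove the duplication.\<close>
  have p_xy: "p \<cdot> \<Delta> P \<cdot> (\<M> x \<otimes> \<M> y) = \<delta> B \<otimes> \<delta> A"
  proof -
    have "p \<cdot> \<Delta> P \<cdot> (\<M> x \<otimes> \<M> y) = (\<Delta> B \<otimes> \<Delta> A) \<cdot> (\<one> (\<B> B) \<otimes> \<sigma> (\<B> B) (\<B> A) \<otimes> \<one> (\<B> A))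
        \<cdot> ((p \<cdot> \<M> x) \<otimes> (p \<cdot> \<M> y))"
      using tensor_coalgebra_Comult[of B A, folded p_def P_def, THEN comp_then, of "\<M> x \<otimes> \<M> y"]
      by (simp add: merge P_def)
    also have "\<dots> = (\<Delta> B \<otimes> \<Delta> A) \<cdot> (\<delta> B \<otimes> \<e> B \<otimes> \<e> A \<otimes> \<delta> A)"
      by (simp add: p_x p_y middle_swap)
    also have "\<dots> = (\<Delta> B \<cdot> (\<delta> B \<otimes> \<e> B)) \<otimes> (\<Delta> A \<cdot> (\<e> A \<otimes> \<delta> A))"
      by (simp add: merge_right)
    also have "\<delta> B \<otimes> \<e> B = (\<one> (\<B> B) \<otimes> \<e> B) \<cdot> \<delta> B"
      using merge[of "\<one> (\<B> B)" "\<e> B" "\<delta> B" "\<one> \<I>"] by simp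
    also have "\<e> A \<otimes> \<delta> A = (\<e> A \<otimes> \<one> (\<B> A)) \<cdot> \<delta> A"
      using merge[of "\<e> A" "\<one> (\<B> A)" "\<one> \<I>" "\<delta> A"] by simp
    finally show ?thesis
      by (simp add: Counit_left[THEN comp_then] Counit_right[THEN comp_then])
  qed
  \<comment> \<open>Like \<open>\<epsilon> P\<close>, \<open>h\<close> is a retraction of
    \<open>p\<close>, but it rebuilds a point from its two projections. Whereas
    \<open>\<delta> P \<cdot> \<M> (\<epsilon> P)\<close> is just the identity,
    \<open>\<delta> P \<cdot> \<M> h\<close> only sees the components along \<open>x\<close> and
    \<open>y\<close>.\<close>
  define h where "h = \<Delta> P \<cdot> ((\<epsilon> P \<cdot> x) \<otimes> (\<epsilon> P \<cdot> y))"
  have h_typing [simp]: "h \<in> Arr C" "Dom C h = \<B> P" "Cod C h = P"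
    by (simp_all add: h_def) (simp add: P_def)
  have h_alt: "h = \<Delta> P \<cdot> (\<M> x \<otimes> \<M> y) \<cdot> (\<epsilon> (\<B> B) \<otimes> \<epsilon> (\<B> A))"
    by (simp add: h_def merge Epsilon_nat)
  have p_h: "p \<cdot> h = \<one> P"
  proof -
    have "p \<cdot> h = (p \<cdot> \<Delta> P \<cdot> (\<M> x \<otimes> \<M> y)) \<cdot> (\<epsilon> (\<B> B) \<otimes> \<epsilon> (\<B> A))"
      by (simp add: h_alt)
    then show ?thesis
      by (simp only: p_xy) (simp add: merge Delta_Epsilon P_def)
  qed
  \<comment> \<open>Along \<open>b\<close> the first projection is constant, and the second carries
    \<open>b\<close> to \<open>d A\<close>.\<close>
  have b_x: "b \<cdot> x = \<zero> (P \<odot> A) (Cod C x)"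
    by (simp add: b_def x_def P_def merge d_constant)
  have b_y: "b \<cdot> y = (y \<otimes> \<one> A) \<cdot> d A"
    using merge[of "\<e> B" "\<one> (\<B> A) \<otimes> \<one> A" "\<one> \<I>" "d A"]
    by (simp add: b_def y_def merge)
  have q_xyy: "q \<cdot> (\<one> (\<B> P) \<otimes> q) \<cdot> (\<M> x \<otimes> \<M> y \<otimes> y) = \<delta> B \<otimes> (\<Delta> A \<cdot> (\<delta> A \<otimes> \<one> (\<B> A)))"
  proof -
    have "q \<cdot> (\<one> (\<B> P) \<otimes> q) \<cdot> (\<M> x \<otimes> \<M> y \<otimes> y) = q \<cdot> (\<one> (\<B> P) \<otimes> p) \<cdot> (\<M> x \<otimes> (\<d> P \<cdot> (\<M> y \<otimes> y)))"
      by (simp add: q_def merge)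
    also have "\<dots> = (p \<cdot> \<Delta> P \<cdot> (\<M> x \<otimes> \<M> y)) \<cdot> (\<one> (\<B> (\<B> B)) \<otimes> \<d> (\<B> A))"
      using coderiving_nat[of y "\<B> A"] by (simp add: q_p[simplified] merge)
    also have "\<dots> = \<delta> B \<otimes> (\<delta> A \<cdot> \<d> (\<B> A))"
      by (simp only: p_xy) (simp add: merge)
    also have "\<delta> A \<cdot> \<d> (\<B> A) = \<Delta> A \<cdot> (\<delta> A \<otimes> \<one> (\<B> A))"
      by (simp add: coderiving_def Delta_Comult[THEN comp_then] merge Delta_Epsilon)
    finally show ?thesis .
  qed
  have lift_y: "lift \<cdot> \<M> y = (q \<otimes> \<one> A) \<cdot> (\<M> y \<otimes> y \<otimes> \<one> A) \<cdot> (\<one> (\<B> (\<B> A)) \<otimes> d A) \<cdot> d (\<B> A)"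
  proof -
    have "lift \<cdot> \<M> y = (q \<otimes> \<one> A) \<cdot> ((\<one> (\<B> P) \<otimes> b) \<cdot> (\<M> y \<otimes> y)) \<cdot> d (\<B> A)"
      using d_nat[of y "\<B> A"] by (simp add: lift_def)
    also have "(\<one> (\<B> P) \<otimes> b) \<cdot> (\<M> y \<otimes> y) = (\<M> y \<otimes> y \<otimes> \<one> A) \<cdot> (\<one> (\<B> (\<B> A)) \<otimes> d A)"
      by (simp add: merge b_y)
    finally show ?thesis by simp
  qed
  \<comment> \<open>By \<open>p_xy\<close>, \<open>b \<cdot> p\<close> has these same components;
    for \<open>lift\<close> they come from \<open>d_chain\<close> on \<open>A\<close>.\<close>
  have lift_xy: "lift \<cdot> \<Delta> P \<cdot> (\<M> x \<otimes> \<M> y) = \<delta> B \<otimes> (d A \<cdot> \<delta> A)"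
  proof -
    have "lift \<cdot> \<Delta> P \<cdot> (\<M> x \<otimes> \<M> y) = (q \<otimes> \<one> A) \<cdot> (\<M> x \<otimes> (lift \<cdot> \<M> y))"
      by (rule lift_Comult) (simp_all add: b_x)
    also have "\<M> x \<otimes> (lift \<cdot> \<M> y) = (\<one> (\<B> P) \<otimes> q \<otimes> \<one> A) \<cdot> ((\<M> x \<otimes> \<M> y \<otimes> y \<otimes> \<one> A)
        \<cdot> (\<one> (\<B> (\<B> B)) \<otimes> \<one> (\<B> (\<B> A)) \<otimes> d A) \<cdot> (\<one> (\<B> (\<B> B)) \<otimes> d (\<B> A)))"
      by (simp add: lift_y merge)
    also have "(q \<otimes> \<one> A) \<cdot> \<dots> = ((q \<cdot> (\<one> (\<B> P) \<otimes> q) \<cdot> (\<M> x \<otimes> \<M> y \<otimes> y)) \<otimes> \<one> A)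
        \<cdot> ((\<one> (\<B> (\<B> B)) \<otimes> \<one> (\<B> (\<B> A)) \<otimes> d A) \<cdot> (\<one> (\<B> (\<B> B)) \<otimes> d (\<B> A)))"
      using merge[of q "\<one> A" "(\<one> (\<B> P) \<otimes> q) \<cdot> (\<M> x \<otimes> \<M> y \<otimes> y)" "\<one> A"]
        merge[of "\<one> (\<B> P) \<otimes> q" "\<one> A" "\<M> x \<otimes> \<M> y \<otimes> y" "\<one> A"]
      by (simp flip: Comp_assoc')
    also have "\<dots> = \<delta> B \<otimes> (((\<Delta> A \<cdot> (\<delta> A \<otimes> \<one> (\<B> A))) \<otimes> \<one> A) \<cdot> (\<one> (\<B> (\<B> A)) \<otimes> d A) \<cdot> d (\<B> A))"
      by (simp only: q_xyy) (simp add: merge)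
    also have "(\<Delta> A \<cdot> (\<delta> A \<otimes> \<one> (\<B> A))) \<otimes> \<one> A = (\<Delta> A \<otimes> \<one> A) \<cdot> (\<delta> A \<otimes> \<one> (\<B> A) \<otimes> \<one> A)"
      by (simp add: merge_right)
    also have "\<dots> \<cdot> (\<one> (\<B> (\<B> A)) \<otimes> d A) \<cdot> d (\<B> A) = d A \<cdot> \<delta> A"
      by (simp add: d_chain)
    finally show ?thesis .
  qed
  \<comment> \<open>The right-hand side is \<open>b \<cdot> p\<close>, so this is the chain rule
    along \<open>b\<close>. It follows by computing
    \<open>lift \<cdot> \<delta> P \<cdot> \<M> h\<close> in two ways.\<close>
  have lift_eq: "lift = (\<delta> B \<otimes> (d A \<cdot> \<delta> A)) \<cdot> m (\<B> B) (\<B> A)"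
  proof -
    have lift_h: "lift \<cdot> h = b"
    proof -
      have "lift \<cdot> h = (lift \<cdot> \<Delta> P \<cdot> (\<M> x \<otimes> \<M> y)) \<cdot> (\<epsilon> (\<B> B) \<otimes> \<epsilon> (\<B> A))"
        by (simp add: h_alt)
      then show ?thesis
        by (simp only: lift_xy) (simp add: merge Delta_Epsilon b_def)
    qed
    \<comment> \<open>Naturality of \<open>d\<close> at \<open>h\<close> turns the inner
      \<open>lift\<close> of \<open>lift_Delta\<close> into \<open>lift \<cdot> h = b\<close> and
      \<open>\<M> p\<close> into an identity, which restores the definition of
      \<open>lift\<close>.\<close>
    have "lift \<cdot> \<delta> P \<cdot> \<M> h = (q \<otimes> \<one> A) \<cdot> ((\<M> p \<otimes> lift) \<cdot> (\<M> h \<otimes> h)) \<cdot> d P"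
      using lift_Delta d_nat[of h P] by simp
    also have "(\<M> p \<otimes> lift) \<cdot> (\<M> h \<otimes> h) = \<one> (\<B> P) \<otimes> b"
      using Bang_Comp[of p h] by (simp add: merge p_h lift_h)
    also have "(q \<otimes> \<one> A) \<cdot> (\<one> (\<B> P) \<otimes> b) \<cdot> d P = lift"
      by (simp add: lift_def)
    finally have 1: "lift \<cdot> \<delta> P \<cdot> \<M> h = lift" .
    \<comment> \<open>Since \<Delta> is a morphism of !-coalgebras, this composite reduces to
      \<open>\<Delta> P \<cdot> (\<M> x \<otimes> \<M> y) \<cdot> m (\<B> B) (\<B>
      A)\<close>.\<close>
    have "\<delta> P \<cdot> \<M> h = \<Delta> P \<cdot> (\<delta> P \<otimes> \<delta> P) \<cdot> (m (\<B> P) (\<B> P) \<cdot> \<M> ((\<epsilon> P \<cdot> x) \<otimes> (\<epsilon> P \<cdot> y)))"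
      by (simp add: h_def Bang_Comp Delta_Bang_Comult[THEN comp_then])
    also have "m (\<B> P) (\<B> P) \<cdot> \<M> ((\<epsilon> P \<cdot> x) \<otimes> (\<epsilon> P \<cdot> y)) = ((\<M> (\<epsilon> P) \<cdot> \<M> x) \<otimes> (\<M> (\<epsilon> P) \<cdot> \<M> y)) \<cdot> m (\<B> B) (\<B> A)"
      using m_nat[of "\<epsilon> P \<cdot> x" "\<epsilon> P \<cdot> y"] by (simp add: Bang_Comp)
    also have "\<Delta> P \<cdot> (\<delta> P \<otimes> \<delta> P) \<cdot> \<dots> = \<Delta> P \<cdot> (\<M> x \<otimes> \<M> y) \<cdot> m (\<B> B) (\<B> A)"
      by (simp add: merge_then Delta_Bang_Epsilon[THEN comp_then])
    finally have "lift \<cdot> \<delta> P \<cdot> \<M> h = (lift \<cdot> \<Delta> P \<cdot> (\<M> x \<otimes> \<M> y)) \<cdot> m (\<B> B) (\<B> A)"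
      by simp
    then show ?thesis
      by (simp only: 1 lift_xy)
  qed
  have lift_Bang: "lift \<cdot> \<M> z = (q \<otimes> \<one> A) \<cdot> ((\<one> (\<B> P) \<otimes> b) \<cdot> (\<M> z \<otimes> z)) \<cdot> d Z"
    if "z \<in> Arr C" "Dom C z = P" "Cod C z = Z" for z Z
    using that d_nat[of z Z] Cod_Obj[of z] by (simp add: lift_def)
  have "lift \<cdot> \<M> (\<epsilon> B \<otimes> \<epsilon> A) = (\<delta> B \<otimes> (d A \<cdot> \<delta> A)) \<cdot> ((\<M> (\<epsilon> B) \<otimes> \<M> (\<epsilon> A)) \<cdot> m B A)"
    by (simp add: lift_eq m_nat)
  also have "\<dots> = (\<one> (\<B> B) \<otimes> d A) \<cdot> m B A"
    by (simp add: merge_then Delta_Bang_Epsilon)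
  finally have "(\<one> (\<B> B) \<otimes> d A) \<cdot> m B A = lift \<cdot> \<M> (\<epsilon> B \<otimes> \<epsilon> A)" ..
  also have "\<dots> = (q \<otimes> \<one> A) \<cdot> ((\<one> (\<B> P) \<otimes> b) \<cdot> (\<M> (\<epsilon> B \<otimes> \<epsilon> A) \<otimes> (\<epsilon> B \<otimes> \<epsilon> A))) \<cdot> d (B \<odot> A)"
    by (rule lift_Bang) (simp_all add: P_def)
  also have "(\<one> (\<B> P) \<otimes> b) \<cdot> (\<M> (\<epsilon> B \<otimes> \<epsilon> A) \<otimes> (\<epsilon> B \<otimes> \<epsilon> A)) = \<M> (\<epsilon> B \<otimes> \<epsilon> A) \<otimes> (b \<cdot> (\<epsilon> B \<otimes> \<epsilon> A))"
    by (simp add: merge P_def)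
  \<comment> \<open>\<open>d_linear\<close> leaves the direction in \<open>A\<close> untouched and
    erases this copy of \<open>\<B> A\<close>, so that \<open>Counit_right\<close> can cancel the
    \<Delta> on \<open>A\<close> inside \<open>q\<close>.\<close>
  also have "b \<cdot> (\<epsilon> B \<otimes> \<epsilon> A) = (\<epsilon> B \<otimes> \<e> A) \<otimes> \<one> A"
    by (simp add: b_def merge d_linear)
  also have "(q \<otimes> \<one> A) \<cdot> (\<M> (\<epsilon> B \<otimes> \<epsilon> A) \<otimes> ((\<epsilon> B \<otimes> \<e> A) \<otimes> \<one> A)) \<cdot> d (B \<odot> A)
      = ((q \<cdot> (\<M> (\<epsilon> B \<otimes> \<epsilon> A) \<otimes> (\<epsilon> B \<otimes> \<e> A))) \<otimes> \<one> A) \<cdot> d (B \<odot> A)"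
    using merge[of q "\<one> A" "\<M> (\<epsilon> B \<otimes> \<epsilon> A) \<otimes> (\<epsilon> B \<otimes> \<e> A)" "\<one> A"]
    by (simp flip: P_def Comp_assoc')
  also have "q \<cdot> (\<M> (\<epsilon> B \<otimes> \<epsilon> A) \<otimes> (\<epsilon> B \<otimes> \<e> A))
      = (\<d> B \<otimes> \<one> (\<B> A)) \<cdot> (\<one> (\<B> B) \<otimes> \<sigma> B (\<B> A)) \<cdot> (m B A \<otimes> \<one> B)"
  proof -
    have "q = p \<cdot> \<Delta> P \<cdot> (\<one> (\<B> P) \<otimes> \<epsilon> P)"
      by (simp add: q_def coderiving_def)
    also have "\<dots> = (\<Delta> B \<otimes> \<Delta> A) \<cdot> (\<one> (\<B> B) \<otimes> \<sigma> (\<B> B) (\<B> A) \<otimes> \<one> (\<B> A)) \<cdot> ((p \<otimes> p) \<cdot> (\<one> (\<B> P) \<otimes> \<epsilon> P))"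
      using tensor_coalgebra_Comult[of B A, folded p_def P_def, THEN comp_then, of "\<one> (\<B> P) \<otimes> \<epsilon> P"]
      by (simp add: P_def)
    also have "(p \<otimes> p) \<cdot> (\<one> (\<B> P) \<otimes> \<epsilon> P) = p \<otimes> \<one> P"
      by (simp add: merge counit)
    finally have q_eq: "q = (\<Delta> B \<otimes> \<Delta> A) \<cdot> (\<one> (\<B> B) \<otimes> \<sigma> (\<B> B) (\<B> A) \<otimes> \<one> (\<B> A)) \<cdot> (p \<otimes> \<one> P)" .
    have "q \<cdot> (\<M> (\<epsilon> B \<otimes> \<epsilon> A) \<otimes> (\<epsilon> B \<otimes> \<e> A)) = (\<Delta> B \<otimes> \<Delta> A)
        \<cdot> (\<one> (\<B> B) \<otimes> \<sigma> (\<B> B) (\<B> A) \<otimes> \<one> (\<B> A)) \<cdot> ((p \<cdot> \<M> (\<epsilon> B \<otimes> \<epsilon> A)) \<otimes> (\<epsilon> B \<otimes> \<e> A))"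
      unfolding q_eq by (simp add: P_def merge_left merge)
    also have "p \<cdot> \<M> (\<epsilon> B \<otimes> \<epsilon> A) = m B A"
    proof -
      have "m (\<B> B) (\<B> A) \<cdot> \<M> (\<epsilon> B \<otimes> \<epsilon> A) = (\<M> (\<epsilon> B) \<otimes> \<M> (\<epsilon> A)) \<cdot> m B A"
        by (simp add: m_nat)
      then show ?thesis
        by (simp add: p_def tensor_coalgebra_def merge_then Delta_Bang_Epsilon)
    qed
    also have "m B A \<otimes> (\<epsilon> B \<otimes> \<e> A) = (\<one> (\<B> B) \<otimes> \<one> (\<B> A) \<otimes> \<epsilon> B \<otimes> \<e> A) \<cdot> (m B A \<otimes> \<one> B)"
      using merge[of "\<one> (\<B> B) \<otimes> \<one> (\<B> A)" "\<epsilon> B \<otimes> \<e> A" "m B A" "\<one> B"] by simp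
    finally show ?thesis
      by (simp add: middle_swap[THEN comp_then] merge_right_then Counit_right coderiving_def)
  qed
  also have "((\<d> B \<otimes> \<one> (\<B> A)) \<cdot> (\<one> (\<B> B) \<otimes> \<sigma> B (\<B> A)) \<cdot> (m B A \<otimes> \<one> B)) \<otimes> \<one> A
      = (\<d> B \<otimes> \<one> (\<B> A) \<otimes> \<one> A) \<cdot> (\<one> (\<B> B) \<otimes> \<sigma> B (\<B> A) \<otimes> \<one> A) \<cdot> (m B A \<otimes> \<one> B \<otimes> \<one> A)"
    using merge[of "\<d> B \<otimes> \<one> (\<B> A)" "\<one> A" "(\<one> (\<B> B) \<otimes> \<sigma> B (\<B> A)) \<cdot> (m B A \<otimes> \<one> B)" "\<one> A"]
      merge[of "\<one> (\<B> B) \<otimes> \<sigma> B (\<B> A)" "\<one> A" "m B A \<otimes> \<one> B" "\<one> A"] by simp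
  finally show ?thesis
    by simp
qed

end

section \<open>The maps J and K\<close>

text \<open>By coassociativity both copies of \<open>A\<close> come out of a single \<Delta>, whose
  cocommutativity absorbs the swap.\<close>

lemma (in coalgebra_modality) coderiving_interchange:
  assumes [simp]: "A \<in> Obj C"
  shows "\<d> A \<cdot> (\<d> A \<otimes> \<one> A) \<cdot> (\<one> (\<B> A) \<otimes> \<sigma> A A) = \<d> A \<cdot> (\<d> A \<otimes> \<one> A)"
proof -
  have 1: "\<d> A \<cdot> (\<d> A \<otimes> \<one> A) = \<Delta> A \<cdot> (\<one> (\<B> A) \<otimes> \<Delta> A) \<cdot> (\<one> (\<B> A) \<otimes> \<epsilon> A \<otimes> \<epsilon> A)"
  proof -
    have "\<d> A \<cdot> (\<d> A \<otimes> \<one> A) = \<Delta> A \<cdot> (\<Delta> A \<otimes> \<one> (\<B> A)) \<cdot> (\<one> (\<B> A) \<otimes> \<epsilon> A \<otimes> \<epsilon> A)"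
      by (simp add: coderiving_def merges)
    then show ?thesis
      by (simp only: Comult_assoc assms)
  qed
  have "(\<one> (\<B> A) \<otimes> \<Delta> A) \<cdot> (\<one> (\<B> A) \<otimes> \<epsilon> A \<otimes> \<epsilon> A) \<cdot> (\<one> (\<B> A) \<otimes> \<sigma> A A)
    = (\<one> (\<B> A) \<otimes> (\<Delta> A \<cdot> \<sigma> (\<B> A) (\<B> A))) \<cdot> (\<one> (\<B> A) \<otimes> \<epsilon> A \<otimes> \<epsilon> A)"
    by (simp add: merge Sym_natural')
  also have "\<dots> = (\<one> (\<B> A) \<otimes> \<Delta> A) \<cdot> (\<one> (\<B> A) \<otimes> \<epsilon> A \<otimes> \<epsilon> A)"
    by (simp only: Comult_comm assms)
  finally show ?thesis
    by (simp only: 1) simp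
qed

context deriving_transformation
begin

text \<open>This is \<open>d_product\<close> with \<epsilon> on the second leg; in the second
  summand \<open>d_linear\<close> and \<open>Counit_right\<close> leave an identity.\<close>

lemma d_coderiving:
  assumes [simp]: "A \<in> Obj C"
  shows "d A \<cdot> \<d> A
    = (\<d> A \<otimes> \<one> A) \<cdot> (\<one> (\<B> A) \<otimes> \<sigma> A A) \<cdot> (d A \<otimes> \<one> A) \<oplus> \<one> (\<B> A \<odot> A)"
proof -
  have "d A \<cdot> \<d> A = (\<Delta> A \<otimes> \<one> A) \<cdot> ((\<one> (\<B> A) \<otimes> \<sigma> (\<B> A) A) \<cdot> (d A \<otimes> \<one> (\<B> A)) \<cdot> (\<one> (\<B> A) \<otimes> \<epsilon> A))
      \<oplus> (\<Delta> A \<otimes> \<one> A) \<cdot> ((\<one> (\<B> A) \<otimes> d A) \<cdot> (\<one> (\<B> A) \<otimes> \<epsilon> A))"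
    by (simp add: coderiving_def d_product[THEN comp_then] distribs)
  also have "(\<one> (\<B> A) \<otimes> \<sigma> (\<B> A) A) \<cdot> (d A \<otimes> \<one> (\<B> A)) \<cdot> (\<one> (\<B> A) \<otimes> \<epsilon> A)
      = (\<one> (\<B> A) \<otimes> \<epsilon> A \<otimes> \<one> A) \<cdot> (\<one> (\<B> A) \<otimes> \<sigma> A A) \<cdot> (d A \<otimes> \<one> A)"
  proof -
    have "(d A \<otimes> \<one> (\<B> A)) \<cdot> (\<one> (\<B> A) \<otimes> \<epsilon> A) = (\<one> (\<B> A) \<otimes> \<one> A \<otimes> \<epsilon> A) \<cdot> (d A \<otimes> \<one> A)"
      by (simp add: merges)
    moreover have swap: "(\<one> (\<B> A) \<otimes> \<sigma> (\<B> A) A) \<cdot> (\<one> (\<B> A) \<otimes> (\<one> A \<otimes> \<epsilon> A))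
        = (\<one> (\<B> A) \<otimes> (\<epsilon> A \<otimes> \<one> A)) \<cdot> (\<one> (\<B> A) \<otimes> \<sigma> A A)"
      by (simp add: merge Sym_natural')
    ultimately show ?thesis
      by (simp add: swap[THEN comp_then])
  qed
  also have "(\<Delta> A \<otimes> \<one> A) \<cdot> ((\<one> (\<B> A) \<otimes> \<epsilon> A \<otimes> \<one> A) \<cdot> (\<one> (\<B> A) \<otimes> \<sigma> A A) \<cdot> (d A \<otimes> \<one> A))
      = (\<d> A \<otimes> \<one> A) \<cdot> (\<one> (\<B> A) \<otimes> \<sigma> A A) \<cdot> (d A \<otimes> \<one> A)"
    by (simp add: coderiving_def merge_right_then)
  also have "(\<Delta> A \<otimes> \<one> A) \<cdot> ((\<one> (\<B> A) \<otimes> d A) \<cdot> (\<one> (\<B> A) \<otimes> \<epsilon> A)) = \<one> (\<B> A \<odot> A)"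
    by (simp add: merge d_linear merge_right Counit_right)
  finally show ?thesis .
qed

text \<open>On functions, \<open>\<d> A \<cdot> d A\<close> is the Euler operator, multiplying
  degree n by n. So \<open>J\<close> multiplies it by n + 1, while \<open>K\<close> multiplies by n
  for positive n and fixes constants.\<close>

definition J where "J A = \<d> A \<cdot> d A \<oplus> \<one> (\<B> A)"

abbreviation K where "K \<equiv> antiderivative_K C d"

lemma J_typing [simp]:
  assumes "A \<in> Obj C"
  shows "J A \<in> Arr C" "Dom C (J A) = \<B> A" "Cod C (J A) = \<B> A"
  using assms by (simp_all add: J_def)

lemma K_typing [simp]:
  assumes "A \<in> Obj C"
  shows "K A \<in> Arr C" "Dom C (K A) = \<B> A" "Cod C (K A) = \<B> A"
  using assms by (simp_all add: antiderivative_K_def)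

lemma Bang_Zero_coderiving: "A \<in> Obj C \<Longrightarrow> \<M> (\<zero> A A) \<cdot> \<d> A = \<zero> (\<B> A) (\<B> A \<odot> A)"
  by (simp add: coderiving_nat)

lemma d_Bang_Zero: "A \<in> Obj C \<Longrightarrow> d A \<cdot> \<M> (\<zero> A A) = \<zero> (\<B> A \<odot> A) (\<B> A)"
  using d_nat[of "\<zero> A A" A] by simp

lemma Bang_Zero_Bang_Zero: "A \<in> Obj C \<Longrightarrow> \<M> (\<zero> A A) \<cdot> \<M> (\<zero> A A) = \<M> (\<zero> A A)"
  by (simp flip: Bang_Comp)

lemma K_Bang_Zero: "A \<in> Obj C \<Longrightarrow> K A \<cdot> \<M> (\<zero> A A) = \<M> (\<zero> A A)"
  and Bang_Zero_K: "A \<in> Obj C \<Longrightarrow> \<M> (\<zero> A A) \<cdot> K A = \<M> (\<zero> A A)"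
  by (simp_all add: antiderivative_K_def distribs d_Bang_Zero Bang_Zero_Bang_Zero
      Bang_Zero_coderiving[THEN comp_then])

text \<open>The identity in \<open>d_coderiving\<close> becomes the identity in \<open>J\<close>;
  \<open>coderiving_interchange\<close> removes \<sigma> from the other summand, and !0 contributes
  nothing.\<close>

lemma K_coderiving:
  assumes [simp]: "A \<in> Obj C"
  shows "K A \<cdot> \<d> A = \<d> A \<cdot> (J A \<otimes> \<one> A)"
proof -
  have "K A \<cdot> \<d> A = (\<d> A \<cdot> (\<d> A \<otimes> \<one> A) \<cdot> (\<one> (\<B> A) \<otimes> \<sigma> A A)) \<cdot> (d A \<otimes> \<one> A) \<oplus> \<d> A"
    by (simp add: antiderivative_K_def distribs d_coderiving Bang_Zero_coderiving)
  also have "\<dots> = \<d> A \<cdot> (J A \<otimes> \<one> A)"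
    by (simp only: coderiving_interchange assms) (simp add: J_def distribs merge)
  finally show ?thesis .
qed

text \<open>Dual to \<open>K_coderiving\<close>, with \<open>d_interchange\<close> removing
  \<sigma>.\<close>

lemma d_K:
  assumes [simp]: "A \<in> Obj C"
  shows "d A \<cdot> K A = (J A \<otimes> \<one> A) \<cdot> d A"
proof -
  have "d A \<cdot> K A = (\<d> A \<otimes> \<one> A) \<cdot> ((\<one> (\<B> A) \<otimes> \<sigma> A A) \<cdot> (d A \<otimes> \<one> A) \<cdot> d A) \<oplus> d A"
    by (simp add: antiderivative_K_def distribs d_coderiving[THEN comp_then] d_Bang_Zero)
  also have "\<dots> = (J A \<otimes> \<one> A) \<cdot> d A"
    by (simp only: d_interchange[symmetric] assms) (simp add: J_def distribs merge_then)
  finally show ?thesis .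
qed

lemma K_natural: "natural_transformation C \<B> \<M> \<B> \<M> K"
proof -
  have "\<M> f \<cdot> K (Cod C f) = K (Dom C f) \<cdot> \<M> f" if [simp]: "f \<in> Arr C" for f
  proof -
    have "\<M> f \<cdot> K (Cod C f) = \<d> (Dom C f) \<cdot> ((\<M> f \<otimes> f) \<cdot> d (Cod C f)) \<oplus> \<M> (f \<cdot> \<zero> (Cod C f) (Cod C f))"
      by (simp add: antiderivative_K_def distribs coderiving_nat[THEN comp_then] Bang_Comp del: Comp_Zero')
    also have "\<dots> = \<d> (Dom C f) \<cdot> d (Dom C f) \<cdot> \<M> f \<oplus> \<M> (\<zero> (Dom C f) (Dom C f) \<cdot> f)"
      by (simp add: d_nat)
    also have "\<dots> = K (Dom C f) \<cdot> \<M> f"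
      by (simp add: antiderivative_K_def distribs Bang_Comp del: Zero_Comp')
    finally show ?thesis .
  qed
  then show ?thesis
    by (auto simp: natural_transformation_def)
qed

end

lemma (in integral_transformation) s_typing [simp]:
  assumes "A \<in> Obj C"
  shows "s A \<in> Arr C" "Dom C (s A) = \<B> A" "Cod C (s A) = \<B> A \<odot> A"
  using s_natural assms by (simp_all add: natural_transformation_def)

section \<open>Rescaling by a distribution on scalars\<close>

context monoidal_coalgebra_modality
begin

text \<open>
  With \<open>w\<close> read as a distribution on scalars, \<open>act w A\<close> sends a function \<open>f\<close> on \<open>A\<close> to
  \<open>x \<mapsto> w (t \<mapsto> f (t x))\<close>.
\<close>

definition act where "act w A = (w \<otimes> \<one> (\<B> A)) \<cdot> m \<I> A"

lemma act_typing [simp]: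
  assumes "w \<in> Arr C" "Dom C w = \<I>" "Cod C w = \<B> \<I>" "A \<in> Obj C"
  shows "act w A \<in> Arr C" "Dom C (act w A) = \<B> A" "Cod C (act w A) = \<B> A"
  using assms by (simp_all add: act_def)

text \<open>A linear factor taken at the scaled point t x is t times the factor at x; the extra t
  changes \<open>w\<close> into \<open>w \<cdot> \<d> \<I>\<close>.\<close>

lemma act_coderiving:
  assumes [simp]: "w \<in> Arr C" "Dom C w = \<I>" "Cod C w = \<B> \<I>" "A \<in> Obj C"
  shows "act w A \<cdot> \<d> A = \<d> A \<cdot> (act (w \<cdot> \<d> \<I>) A \<otimes> \<one> A)"
proof -
  have "act w A \<cdot> \<d> A = (w \<otimes> \<one> (\<B> A)) \<cdot> (\<d> \<I> \<otimes> \<d> A) \<cdot> (m \<I> A \<otimes> \<one> A)"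
    using m_coderiving[of "\<I>" A] by (simp add: act_def)
  also have "\<dots> = \<d> A \<cdot> ((w \<cdot> \<d> \<I>) \<otimes> \<one> (\<B> A) \<otimes> \<one> A) \<cdot> (m \<I> A \<otimes> \<one> A)"
    using merge[of "\<one> \<I>" "\<d> A" "w \<cdot> \<d> \<I>" "\<one> (\<B> A) \<otimes> \<one> A"]
    by (simp add: merge merge_then)
  also have "\<dots> = \<d> A \<cdot> (act (w \<cdot> \<d> \<I>) A \<otimes> \<one> A)"
    by (simp add: act_def merge_left)
  finally show ?thesis .
qed

end

text \<open>The derivative of f (t x) is t f' (t x), which is \<open>d_monoidal\<close> with scalars
  as first variable. The weight changes exactly as in \<open>act_coderiving\<close>.\<close>

lemma (in monoidal_differential) d_act:
  assumes [simp]: "w \<in> Arr C" "Dom C w = \<I>" "Cod C w = \<B> \<I>" "A \<in> Obj C"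
  shows "d A \<cdot> act w A = (act (w \<cdot> \<d> \<I>) A \<otimes> \<one> A) \<cdot> d A"
proof -
  have "d A \<cdot> act w A = (w \<otimes> \<one> (\<B> A) \<otimes> \<one> A) \<cdot> ((\<one> (\<B> \<I>) \<otimes> d A) \<cdot> m \<I> A)"
    using merge[of "\<one> \<I>" "d A" w "\<one> (\<B> A)"]
    by (simp add: act_def merge flip: Comp_assoc')
  also have "(\<one> (\<B> \<I>) \<otimes> d A) \<cdot> m \<I> A = (\<d> \<I> \<otimes> \<one> (\<B> A) \<otimes> \<one> A) \<cdot> (m \<I> A \<otimes> \<one> A) \<cdot> d A"
    using d_monoidal[of A "\<I>"] by simp
  also have "(w \<otimes> \<one> (\<B> A) \<otimes> \<one> A) \<cdot> \<dots> = (act (w \<cdot> \<d> \<I>) A \<otimes> \<one> A) \<cdot> d A"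
    by (simp add: act_def merge_then merge_left_then)
  finally show ?thesis .
qed

section \<open>Antiderivatives\<close>

locale monoidal_calculus = monoidal_differential C m m\<^sub>I d +
  monoidal_integral_transformation C m m\<^sub>I s + calculus_category C d s
  for C :: "('o, 'm, 'x) coalg_cat_scheme" (structure)
    and m :: "'o \<Rightarrow> 'o \<Rightarrow> 'm" and m\<^sub>I :: "'m" and d s :: "'o \<Rightarrow> 'm"
begin

definition average where "average = act (m\<^sub>I \<cdot> s \<I>)"

lemma average_typing [simp]:
  assumes "A \<in> Obj C"
  shows "average A \<in> Arr C" "Dom C (average A) = \<B> A" "Cod C (average A) = \<B> A"
  using assms by (simp_all add: average_def)

text \<open>Insert \<open>m_unit_left\<close> in front of \<open>s A\<close> and expand by
  \<open>s_monoidal_left\<close> at \<I>: the integral then acts on the scalar variable only, and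
  \<open>A\<close> meets the coderiving transformation.\<close>

lemma s_eq_average:
  assumes [simp]: "A \<in> Obj C"
  shows "s A = \<d> A \<cdot> (average A \<otimes> \<one> A)"
proof -
  have "s A = (m\<^sub>I \<otimes> \<one> (\<B> A)) \<cdot> (m \<I> A \<cdot> s A)"
    using m_unit_left[THEN comp_then, of A "s A"] by simp
  also have "m \<I> A \<cdot> s A = (s \<I> \<otimes> \<d> A) \<cdot> (m \<I> A \<otimes> \<one> A)"
    using s_monoidal_left[of "\<I>" A] by simp
  also have "(m\<^sub>I \<otimes> \<one> (\<B> A)) \<cdot> \<dots> = \<d> A \<cdot> ((m\<^sub>I \<cdot> s \<I>) \<otimes> \<one> (\<B> A) \<otimes> \<one> A) \<cdot> (m \<I> A \<otimes> \<one> A)"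
    using merge[of "\<one> \<I>" "\<d> A" "m\<^sub>I \<cdot> s \<I>" "\<one> (\<B> A) \<otimes> \<one> A"]
    by (simp add: merge merge_then)
  also have "\<dots> = \<d> A \<cdot> (average A \<otimes> \<one> A)"
    by (simp add: average_def act_def merge_left)
  finally show ?thesis .
qed

text \<open>Passing \<open>d\<close> and passing \<open>\<d>\<close> change the weight of
  \<open>average\<close> in the same way, so it commutes with their composite.\<close>

lemma J_average:
  assumes [simp]: "A \<in> Obj C"
  shows "J A \<cdot> average A = average A \<cdot> J A"
  by (simp add: J_def average_def distribs d_act act_coderiving[THEN comp_then])

lemma s_J:
  assumes [simp]: "A \<in> Obj C"
  shows "s A \<cdot> (J A \<otimes> \<one> A) = \<d> A"
proof -
  let ?w = "m\<^sub>I \<cdot> s \<I> \<cdot> \<d> \<I>"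
  \<comment> \<open>Moving the average behind the second coderiving makes it act on the
    \<open>\<B> A\<close> leg alone, so the symmetry of the iterated coderiving carries over to
    \<open>s\<close>.\<close>
  have s_coderiving: "s A \<cdot> (\<d> A \<otimes> \<one> A) = \<d> A \<cdot> (\<d> A \<otimes> \<one> A) \<cdot> (act ?w A \<otimes> \<one> A \<otimes> \<one> A)"
  proof -
    have "s A \<cdot> (\<d> A \<otimes> \<one> A) = \<d> A \<cdot> (average A \<otimes> \<one> A) \<cdot> (\<d> A \<otimes> \<one> A)"
      by (simp add: s_eq_average)
    then show ?thesis
      by (simp add: average_def act_coderiving merge merge_right)
  qed
  have "s A \<cdot> (\<d> A \<otimes> \<one> A) \<cdot> (\<one> (\<B> A) \<otimes> \<sigma> A A)
    = (\<d> A \<cdot> (\<d> A \<otimes> \<one> A) \<cdot> (\<one> (\<B> A) \<otimes> \<sigma> A A)) \<cdot> (act ?w A \<otimes> \<one> A \<otimes> \<one> A)"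
    by (simp only: s_coderiving) (simp add: merge)
  also have "\<dots> = s A \<cdot> (\<d> A \<otimes> \<one> A)"
    by (simp only: coderiving_interchange s_coderiving assms)
  finally have symm: "s A \<cdot> (\<d> A \<otimes> \<one> A) \<cdot> (\<one> (\<B> A) \<otimes> \<sigma> A A) = s A \<cdot> (\<d> A \<otimes> \<one> A)" .
  \<comment> \<open>Expanding \<open>d A \<cdot> \<d> A\<close> gives a summand \<open>s A\<close>
    and one containing \<sigma>, which \<open>symm\<close> removes.\<close>
  have "\<d> A = (s A \<cdot> d A \<oplus> \<M> (\<zero> A A)) \<cdot> \<d> A"
    by (simp add: second_fundamental_theorem)
  also have "\<dots> = (s A \<cdot> (\<d> A \<otimes> \<one> A) \<cdot> (\<one> (\<B> A) \<otimes> \<sigma> A A)) \<cdot> (d A \<otimes> \<one> A) \<oplus> s A"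
    by (simp add: distribs Bang_Zero_coderiving d_coderiving)
  also have "\<dots> = s A \<cdot> (J A \<otimes> \<one> A)"
    by (simp only: symm) (simp add: J_def distribs merge)
  finally show ?thesis ..
qed

lemma K_s:
  assumes [simp]: "A \<in> Obj C"
  shows "K A \<cdot> s A = \<d> A"
proof -
  have "K A \<cdot> s A = \<d> A \<cdot> ((J A \<cdot> average A) \<otimes> \<one> A)"
    by (simp add: s_eq_average K_coderiving[THEN comp_then] merge)
  also have "\<dots> = s A \<cdot> (J A \<otimes> \<one> A)"
    by (simp add: s_eq_average J_average merge)
  finally show ?thesis
    by (simp add: s_J)
qed

text \<open>In positive degree n, \<open>s A \<cdot> d A\<close> is the identity and averaging the
  derivative, of degree n - 1, divides by n; the !0 summand handles constants.\<close>

definition K_inverse where "K_inverse A = s A \<cdot> (average A \<otimes> \<one> A) \<cdot> d A \<oplus> \<M> (\<zero> A A)"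

lemma K_inverse_typing [simp]:
  assumes "A \<in> Obj C"
  shows "K_inverse A \<in> Arr C" "Dom C (K_inverse A) = \<B> A" "Cod C (K_inverse A) = \<B> A"
  using assms by (simp_all add: K_inverse_def)

text \<open>\<open>K_s\<close> leaves \<d>, which \<open>s_eq_average\<close> read backwards
  combines with the average into \<open>s\<close>; the Second Fundamental Theorem finishes.\<close>

lemma K_K_inverse:
  assumes [simp]: "A \<in> Obj C"
  shows "K A \<cdot> K_inverse A = \<one> (\<B> A)"
proof -
  have "K A \<cdot> K_inverse A = (\<d> A \<cdot> (average A \<otimes> \<one> A)) \<cdot> d A \<oplus> \<M> (\<zero> A A)"
    by (simp add: K_inverse_def distribs K_Bang_Zero K_s[THEN comp_then])
  then show ?thesis
    by (simp only: second_fundamental_theorem assms flip: s_eq_average)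
qed

text \<open>Here \<open>d_K\<close> produces \<open>J\<close> behind the average; once commuted to
  the front, it is absorbed by \<open>s_J\<close>.\<close>

lemma K_inverse_K:
  assumes [simp]: "A \<in> Obj C"
  shows "K_inverse A \<cdot> K A = \<one> (\<B> A)"
proof -
  have "K_inverse A \<cdot> K A = s A \<cdot> ((average A \<cdot> J A) \<otimes> \<one> A) \<cdot> d A \<oplus> \<M> (\<zero> A A)"
    by (simp add: K_inverse_def distribs Bang_Zero_K d_K merge_then)
  also have "(average A \<cdot> J A) \<otimes> \<one> A = (J A \<otimes> \<one> A) \<cdot> (average A \<otimes> \<one> A)"
    by (simp add: J_average merge)
  also have "s A \<cdot> \<dots> \<cdot> d A = (\<d> A \<cdot> (average A \<otimes> \<one> A)) \<cdot> d A"
    by (simp add: s_J[THEN comp_then])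
  finally show ?thesis
    by (simp only: second_fundamental_theorem assms flip: s_eq_average)
qed

lemma inverse_maps_K: "A \<in> Obj C \<Longrightarrow> inverse_maps C (K A) (K_inverse A)"
  by (simp add: inverse_maps_def K_K_inverse K_inverse_K)

lemma inverse_map_K:
  assumes [simp]: "A \<in> Obj C"
  shows "inverse_map C (K A) = K_inverse A"
  unfolding inverse_map_def
proof (rule the_equality)
  show "inverse_maps C (K A) (K_inverse A)"
    by (simp add: inverse_maps_K)
  fix g assume g: "inverse_maps C (K A) g"
  then have "g = g \<cdot> (K A \<cdot> K_inverse A)"
    by (simp add: inverse_maps_def K_K_inverse)
  also have "\<dots> = K_inverse A"
    using g comp_then[of g "K A" "\<one> (\<B> A)" "K_inverse A"] by (simp add: inverse_maps_def del: Comp_assoc')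
  finally show "g = K_inverse A" .
qed

lemma s_eq_K_inverse_coderiving:
  assumes [simp]: "A \<in> Obj C"
  shows "s A = K_inverse A \<cdot> \<d> A"
proof -
  have "s A = (K_inverse A \<cdot> K A) \<cdot> s A"
    by (simp add: K_inverse_K)
  also have "\<dots> = K_inverse A \<cdot> \<d> A"
    by (simp add: K_s)
  finally show ?thesis .
qed

end

theorem theorem6p13:
  fixes C :: "('o, 'm, 'x) coalg_cat_scheme" (structure)
    and d s :: "'o \<Rightarrow> 'm" and m :: "'o \<Rightarrow> 'o \<Rightarrow> 'm" and m\<^sub>I :: "'m"
  assumes "calculus_category C d s"
    and "monoidal_coalgebra_modality C m m\<^sub>I"
    and "monoidal_integral_transformation C m m\<^sub>I s"
  shows "natural_isomorphism C \<B> \<M> \<B> \<M> (antiderivative_K C d)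
    \<and> (\<forall>A \<in> Obj C. s A = inverse_map C (antiderivative_K C d A) \<cdot> \<d> A)"
proof -
  interpret calculus_category C d s by fact
  interpret monoidal_integral_transformation C m m\<^sub>I s by fact
  interpret monoidal_calculus C m m\<^sub>I d s by unfold_locales
  show ?thesis
    using K_natural inverse_maps_K
    by (auto simp: natural_isomorphism_def isomorphism_def inverse_map_K
        s_eq_K_inverse_coderiving)
qed

end
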